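(* Consider the optimal control problem of $N$ agents $$\min_u\ \frac1N\sum_{i=1}^N\int_0^T\Big[J(u_i,\tilde m(x_i))+\tfrac\alpha2u_i^2\Big]dt\quad\text{s.t.}\quad\dot x_i=\frac1N\sum_{j=1}^NG(x_i,x_j,u_i),\quad x_i(0)=x_{i,0},\quad i=1,\dots,N, \tag{A}$$ where each agent $i$ has its own control $u_i=u_i(t)$, and the optimal control problem $$\min_u\ \int_0^T\!\!\int\Big[J(u,\tilde m(x))+\tfrac\alpha2u^2\Big]f^{\mathrm{MO}}\,dx\,dt\quad\text{s.t.}\quad0=\partial_tf^{\mathrm{MO}}+\mathrm{div}_x\Big(f^{\mathrm{MO}}\int G(x,\hat x,u)f^{\mathrm{MO}}(t,\hat x)\,d\hat x\Big),\quad f^{\mathrm{MO}}(0,x)=f_0^{\mathrm{MO}}(x), \tag{B}$$ with control $u=u(t,x)$, for the density $f^{\mathrm{MO}}:[0,T]\times\mathbb R^n\to\mathbb R$ of agents. Let $f^{\mathrm{OM}}:[0,T]\times\mathbb R^n\times\mathbb R^n\to\mathbb R$, $f^{\mathrm{OM}}=f^{\mathrm{OM}}(t,x,\lambda)$, be the distribution function which satisfies the mean-field limit of the first-order optimality conditions of (A). Let $\Lambda=\Lambda(t,x)$ be the multiplier in the optimality system of (B). Then the solution of the mean-field limit of the optimality conditions of (A) and the solution of the optimality conditions of (B) can be formally identified by $$\nabla_x\Lambda(t,x)=-\int\lambda\,f^{\mathrm{OM}}_2(t,x,\lambda)\,d\lambda$$ for all $t\ge0$ and all $x$ in the support of $f^{\mathrm{MO}}$,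 where the function $f_2^{\mathrm{OM}}$ is given by $$f^{\mathrm{OM}}(t,x,\lambda)=f^{\mathrm{MO}}(t,x)\,f^{\mathrm{OM}}_2(t,x,\lambda).$$
   Context: **Data.** $x_i=x_i(t)\in\mathbb R^n$, $u_i=u_i(t)\in\mathbb R^{n_u}$, $\alpha>0$; $G:\mathbb R^n\times\mathbb R^n\times\mathbb R^{n_u}\to\mathbb R^n$, $J:\mathbb R^{n_u}\times\mathbb R^n\to\mathbb R$ and $\tilde m:\mathbb R^n\to\mathbb R^n$ are differentiable. $u^2$ means $|u|^2$. $f_2^{\mathrm{OM}}$ is the conditional density, $\int f_2^{\mathrm{OM}}(t,x,\lambda)\,d\lambda=1$. $D_1,D_2,D_u$ are Jacobians in the first, second and third argument of $G$; $\nabla_m$ is the gradient in the second argument of $J$. A hat denotes evaluation at the hatted variables, e.g. $\hat f^{\mathrm{OM}}=f^{\mathrm{OM}}(t,\hat x,\hat\lambda)$, $\hat f^{\mathrm{MO}}=f^{\mathrm{MO}}(t,\hat x)$, $\hat u=u(t,\hat x)$. **Formal setting.** All functions are assumed regular and decaying enough for differentiation and integration by parts; derivatives with respect to densities are $L^2$ (Gateaux) derivatives; the adjoint equation for $\Lambda$ is compared after applying $\nabla_x$ (additive functions of $t$ are irrelevant). "Formally identified" means that, under the stated relations and with the same control $u$, the two systems below coincide, where the control equation of the first system is averaged against $f^{\mathrm{OM}}_2\,d\lambda$. **Mean-field limit of the optimality conditions of (A).** The first-order conditions (Pontryagin) of (A), with multipliers $\lambda_i\in\mathbb R^n$, are the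 state equations and $$\dot\lambda_i=-D\tilde m(x_i)^\top\nabla_mJ(u_i,\tilde m(x_i))-\frac1N\sum_{j=1}^N\big[D_1G(x_i,x_j,u_i)^\top\lambda_i+D_2G(x_j,x_i,u_j)^\top\lambda_j\big],\quad\lambda_i(T)=0,$$ $$0=\nabla_uJ(u_i,\tilde m(x_i))+\alpha u_i+\frac1N\sum_{j=1}^ND_uG(x_i,x_j,u_i)^\top\lambda_i .$$ It is assumed that there exists $u:[0,T]\times\mathbb R^n\to\mathbb R^{n_u}$ with $u(t,x_i(t))=u_i(t)$ for all $i$ and $t$. The mean-field limit is $$0=\partial_tf^{\mathrm{OM}}+\mathrm{div}_x\Big(f^{\mathrm{OM}}\int G(x,\hat x,u)\hat f^{\mathrm{OM}}d\hat xd\hat\lambda\Big)-\mathrm{div}_\lambda\Big(f^{\mathrm{OM}}\Big[\int\big(D_1G(x,\hat x,u)^\top\lambda+D_2G(\hat x,x,\hat u)^\top\hat\lambda\big)\hat f^{\mathrm{OM}}d\hat xd\hat\lambda+D\tilde m(x)^\top\nabla_mJ(u,\tilde m(x))\Big]\Big),$$ with $f^{\mathrm{OM}}(0,x,\lambda)=f^{\mathrm{OM}}_0(x,\lambda)$, and $$0=\nabla_uJ(u,\tilde m(x))+\alpha u+\int D_uG(x,\hat x,u)^\top\lambda\,\hat f^{\mathrm{OM}}\,d\hat xd\hat\lambda .$$ **Optimality conditions of (B)** (formal, $L^2$ sense): $$0=\partial_tf^{\mathrm{MO}}+\mathrm{div}_x\Big(f^{\mathrm{MO}}\int G(x,\hat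 x,u)\hat f^{\mathrm{MO}}d\hat x\Big),$$ $$0=J(u,\tilde m(x))+\tfrac\alpha2u^2-\partial_t\Lambda-\int\big(G(x,\hat x,u)^\top\nabla_x\Lambda+G(\hat x,x,\hat u)^\top\nabla_{\hat x}\hat\Lambda\big)\hat f^{\mathrm{MO}}d\hat x,$$ $$0=\nabla_uJ(u,\tilde m(x))+\alpha u-\int D_uG(x,\hat x,u)^\top\nabla_x\Lambda\,\hat f^{\mathrm{MO}}d\hat x,$$ with $f^{\mathrm{MO}}(0,x)=f_0^{\mathrm{MO}}(x)$ and $\Lambda(T,x)=0$.
   Formalization: The systems coincide only via λ-moments 0 and 1 of the f^OM equation (0th for initial data): the MO system does not fix the λ-shape of f^OM. λ(T)=0 is imposed in the mean; the Λ and u equations are compared on the support of f^MO. *)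

theory Defs
  imports "HOL-Analysis.Analysis"
begin

section \<open>Differential operators\<close>

definition gradient :: "('a::real_inner \<Rightarrow> real) \<Rightarrow> 'a \<Rightarrow> 'a" where
  "gradient f x = (THE D. GDERIV f x :> D)"

definition divergence :: "(real^'n \<Rightarrow> real^'n) \<Rightarrow> real^'n \<Rightarrow> real" where
  "divergence F x = trace (jacobian F (at x))"

text \<open>Time derivatives are one-sided at the end points of the horizon.\<close>

definition dt :: "real \<Rightarrow> (real \<Rightarrow> real) \<Rightarrow> real \<Rightarrow> real" where
  "dt T g t = vector_derivative g (at t within {0..T})"

definition D1 :: "(real^'n \<Rightarrow> real^'n \<Rightarrow> real^'m \<Rightarrow> real^'n) \<Rightarrow> real^'n \<Rightarrow> real^'n \<Rightarrow> real^'m \<Rightarrow> real^'n^'n" where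
  "D1 G x y v = jacobian (\<lambda>z. G z y v) (at x)"

definition D2 :: "(real^'n \<Rightarrow> real^'n \<Rightarrow> real^'m \<Rightarrow> real^'n) \<Rightarrow> real^'n \<Rightarrow> real^'n \<Rightarrow> real^'m \<Rightarrow> real^'n^'n" where
  "D2 G x y v = jacobian (\<lambda>z. G x z v) (at y)"

definition Du :: "(real^'n \<Rightarrow> real^'n \<Rightarrow> real^'m \<Rightarrow> real^'n) \<Rightarrow> real^'n \<Rightarrow> real^'n \<Rightarrow> real^'m \<Rightarrow> real^'m^'n" where
  "Du G x y v = jacobian (\<lambda>w. G x y w) (at v)"

definition grad_u :: "(real^'m \<Rightarrow> real^'n \<Rightarrow> real) \<Rightarrow> real^'m \<Rightarrow> real^'n \<Rightarrow> real^'m" where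
  "grad_u J v p = gradient (\<lambda>w. J w p) v"

definition grad_m :: "(real^'m \<Rightarrow> real^'n \<Rightarrow> real) \<Rightarrow> real^'m \<Rightarrow> real^'n \<Rightarrow> real^'n" where
  "grad_m J v p = gradient (\<lambda>q. J v q) p"


section \<open>Regularity and decay\<close>

definition C1_with :: "'a::real_normed_vector set \<Rightarrow> ('a \<Rightarrow> 'b::real_normed_vector) \<Rightarrow> ('a \<Rightarrow> 'a \<Rightarrow>\<^sub>L 'b) \<Rightarrow> bool" where
  "C1_with S f f' \<longleftrightarrow>
     (\<forall>p\<in>S. (f has_derivative blinfun_apply (f' p)) (at p within S)) \<and> continuous_on S f'"

definition C1_on :: "'a::real_normed_vector set \<Rightarrow> ('a \<Rightarrow> 'b::real_normed_vector) \<Rightarrow> bool" where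
  "C1_on S f \<longleftrightarrow> (\<exists>f'. C1_with S f f')"

definition C2_on :: "'a::real_normed_vector set \<Rightarrow> ('a \<Rightarrow> 'b::real_normed_vector) \<Rightarrow> bool" where
  "C2_on S f \<longleftrightarrow> (\<exists>f'. C1_with S f f' \<and> C1_on S f')"

definition poly_growth :: "('a::real_normed_vector \<Rightarrow> 'b::real_normed_vector) \<Rightarrow> bool" where
  "poly_growth f \<longleftrightarrow> (\<exists>C k. \<forall>z. norm (f z) \<le> C * (1 + norm z) ^ k)"

definition C1_poly_growth :: "('a::real_normed_vector \<Rightarrow> 'b::real_normed_vector) \<Rightarrow> bool" where
  "C1_poly_growth f \<longleftrightarrow> (\<exists>f'. C1_with UNIV f f' \<and> poly_growth f \<and> poly_growth f')"

text \<open>Continuously differentiable up to the end points in time and, together with the first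
  derivatives, decaying in the remaining variables faster than any power, uniformly in time.\<close>

definition C1_rapid_decay :: "real \<Rightarrow> (real \<times> 'a::real_normed_vector \<Rightarrow> real) \<Rightarrow> bool" where
  "C1_rapid_decay T f \<longleftrightarrow>
     (\<exists>f'. C1_with ({0..T} \<times> UNIV) f f' \<and>
       (\<forall>k. \<exists>C. \<forall>t\<in>{0..T}. \<forall>z.
          (1 + norm z) ^ k * (\<bar>f (t, z)\<bar> + norm (f' (t, z))) \<le> C))"

definition density_support :: "(real \<Rightarrow> real^'n \<Rightarrow> real) \<Rightarrow> real \<Rightarrow> (real^'n) set" where
  "density_support f t = closure {x. f t x \<noteq> 0}"


section \<open>Mean-field limit of the optimality conditions of the particle problem\<close>

text \<open>In the integrals over \<open>z\<close> below, \<open>fst z\<close> is the hatted state and \<open>snd z\<close> the hatted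
  multiplier.\<close>

definition OM_velocity ::
  "(real^'n \<Rightarrow> real^'n \<Rightarrow> real^'m \<Rightarrow> real^'n) \<Rightarrow> (real \<Rightarrow> real^'n \<Rightarrow> real^'m) \<Rightarrow>
   (real \<Rightarrow> real^'n \<Rightarrow> real^'n \<Rightarrow> real) \<Rightarrow> real \<Rightarrow> real^'n \<Rightarrow> real^'n" where
  "OM_velocity G u f t x =
     (LINT z|lborel. f t (fst z) (snd z) *\<^sub>R G x (fst z) (u t x))"

definition OM_force ::
  "(real^'n \<Rightarrow> real^'n \<Rightarrow> real^'m \<Rightarrow> real^'n) \<Rightarrow> (real^'m \<Rightarrow> real^'n \<Rightarrow> real) \<Rightarrow>
   (real^'n \<Rightarrow> real^'n) \<Rightarrow> (real \<Rightarrow> real^'n \<Rightarrow> real^'m) \<Rightarrow>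
   (real \<Rightarrow> real^'n \<Rightarrow> real^'n \<Rightarrow> real) \<Rightarrow> real \<Rightarrow> real^'n \<Rightarrow> real^'n \<Rightarrow> real^'n" where
  "OM_force G J mt u f t x l =
     (LINT z|lborel. f t (fst z) (snd z) *\<^sub>R
        (transpose (D1 G x (fst z) (u t x)) *v l
         + transpose (D2 G (fst z) x (u t (fst z))) *v snd z))
     + transpose (jacobian mt (at x)) *v grad_m J (u t x) (mt x)"

definition OM_kinetic ::
  "real \<Rightarrow> (real^'n \<Rightarrow> real^'n \<Rightarrow> real^'m \<Rightarrow> real^'n) \<Rightarrow> (real^'m \<Rightarrow> real^'n \<Rightarrow> real) \<Rightarrow>
   (real^'n \<Rightarrow> real^'n) \<Rightarrow> (real \<Rightarrow> real^'n \<Rightarrow> real^'m) \<Rightarrow>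
   (real \<Rightarrow> real^'n \<Rightarrow> real^'n \<Rightarrow> real) \<Rightarrow> real \<Rightarrow> real^'n \<Rightarrow> real^'n \<Rightarrow> real" where
  "OM_kinetic T G J mt u f t x l =
     dt T (\<lambda>s. f s x l) t
     + divergence (\<lambda>y. f t y l *\<^sub>R OM_velocity G u f t y) x
     - divergence (\<lambda>k. f t x k *\<^sub>R OM_force G J mt u f t x k) l"

definition OM_control ::
  "(real^'n \<Rightarrow> real^'n \<Rightarrow> real^'m \<Rightarrow> real^'n) \<Rightarrow> (real^'m \<Rightarrow> real^'n \<Rightarrow> real) \<Rightarrow>
   (real^'n \<Rightarrow> real^'n) \<Rightarrow> real \<Rightarrow> (real \<Rightarrow> real^'n \<Rightarrow> real^'m) \<Rightarrow>
   (real \<Rightarrow> real^'n \<Rightarrow> real^'n \<Rightarrow> real) \<Rightarrow> real \<Rightarrow> real^'n \<Rightarrow> real^'n \<Rightarrow> real^'m" where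
  "OM_control G J mt \<alpha> u f t x l =
     grad_u J (u t x) (mt x) + \<alpha> *\<^sub>R u t x
     + (LINT z|lborel. f t (fst z) (snd z) *\<^sub>R (transpose (Du G x (fst z) (u t x)) *v l))"

text \<open>The control does not depend on \<open>\<lambda>\<close>, so the control equation is imposed after averaging
  against the conditional density \<open>f2\<close>, which is meaningful only on the support of the marginal.
  The terminal condition \<open>\<lambda>\<^sub>i(T) = 0\<close> of the particle multipliers would concentrate \<open>f T x\<close> at
  \<open>\<lambda> = 0\<close>, which no density in \<open>\<lambda>\<close> can satisfy; it is imposed in the mean.\<close>

definition OM_system ::
  "real \<Rightarrow> (real^'n \<Rightarrow> real^'n \<Rightarrow> real^'m \<Rightarrow> real^'n) \<Rightarrow> (real^'m \<Rightarrow> real^'n \<Rightarrow> real) \<Rightarrow>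
   (real^'n \<Rightarrow> real^'n) \<Rightarrow> real \<Rightarrow> (real^'n \<Rightarrow> real^'n \<Rightarrow> real) \<Rightarrow>
   (real \<Rightarrow> real^'n \<Rightarrow> real^'m) \<Rightarrow> (real \<Rightarrow> real^'n \<Rightarrow> real^'n \<Rightarrow> real) \<Rightarrow>
   (real \<Rightarrow> real^'n \<Rightarrow> real) \<Rightarrow> (real \<Rightarrow> real^'n \<Rightarrow> real^'n \<Rightarrow> real) \<Rightarrow> bool" where
  "OM_system T G J mt \<alpha> f0 u f fMO f2 \<longleftrightarrow>
     (\<forall>t\<in>{0..T}. \<forall>x l. OM_kinetic T G J mt u f t x l = 0) \<and>
     (\<forall>t\<in>{0..T}. \<forall>x\<in>density_support fMO t.
        (LINT l|lborel. f2 t x l *\<^sub>R OM_control G J mt \<alpha> u f t x l) = 0) \<and>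
     (\<forall>x l. f 0 x l = f0 x l) \<and>
     (\<forall>x. (LINT l|lborel. f T x l *\<^sub>R l) = 0)"

text \<open>The same system with the kinetic equation replaced by its \<open>\<lambda>\<close>-moments of order 0 and 1 and
  the initial condition by its moment of order 0. The optimality system of the mean-field problem
  involves \<open>f\<close> only through these moments and does not determine the shape of \<open>f\<close> in \<open>\<lambda>\<close>.\<close>

definition OM_system_moments ::
  "real \<Rightarrow> (real^'n \<Rightarrow> real^'n \<Rightarrow> real^'m \<Rightarrow> real^'n) \<Rightarrow> (real^'m \<Rightarrow> real^'n \<Rightarrow> real) \<Rightarrow>
   (real^'n \<Rightarrow> real^'n) \<Rightarrow> real \<Rightarrow> (real^'n \<Rightarrow> real^'n \<Rightarrow> real) \<Rightarrow>
   (real \<Rightarrow> real^'n \<Rightarrow> real^'m) \<Rightarrow> (real \<Rightarrow> real^'n \<Rightarrow> real^'n \<Rightarrow> real) \<Rightarrow>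
   (real \<Rightarrow> real^'n \<Rightarrow> real) \<Rightarrow> (real \<Rightarrow> real^'n \<Rightarrow> real^'n \<Rightarrow> real) \<Rightarrow> bool" where
  "OM_system_moments T G J mt \<alpha> f0 u f fMO f2 \<longleftrightarrow>
     (\<forall>t\<in>{0..T}. \<forall>x. (LINT l|lborel. OM_kinetic T G J mt u f t x l) = 0) \<and>
     (\<forall>t\<in>{0..T}. \<forall>x. (LINT l|lborel. OM_kinetic T G J mt u f t x l *\<^sub>R l) = 0) \<and>
     (\<forall>t\<in>{0..T}. \<forall>x\<in>density_support fMO t.
        (LINT l|lborel. f2 t x l *\<^sub>R OM_control G J mt \<alpha> u f t x l) = 0) \<and>
     (\<forall>x. (LINT l|lborel. f 0 x l) = (LINT l|lborel. f0 x l)) \<and>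
     (\<forall>x. (LINT l|lborel. f T x l *\<^sub>R l) = 0)"


section \<open>Optimality conditions of the mean-field problem\<close>

definition MO_continuity ::
  "real \<Rightarrow> (real^'n \<Rightarrow> real^'n \<Rightarrow> real^'m \<Rightarrow> real^'n) \<Rightarrow> (real \<Rightarrow> real^'n \<Rightarrow> real^'m) \<Rightarrow>
   (real \<Rightarrow> real^'n \<Rightarrow> real) \<Rightarrow> real \<Rightarrow> real^'n \<Rightarrow> real" where
  "MO_continuity T G u f t x =
     dt T (\<lambda>s. f s x) t
     + divergence (\<lambda>y. f t y *\<^sub>R (LINT xh|lborel. f t xh *\<^sub>R G y xh (u t y))) x"

definition MO_adjoint ::
  "real \<Rightarrow> (real^'n \<Rightarrow> real^'n \<Rightarrow> real^'m \<Rightarrow> real^'n) \<Rightarrow> (real^'m \<Rightarrow> real^'n \<Rightarrow> real) \<Rightarrow>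
   (real^'n \<Rightarrow> real^'n) \<Rightarrow> real \<Rightarrow> (real \<Rightarrow> real^'n \<Rightarrow> real^'m) \<Rightarrow>
   (real \<Rightarrow> real^'n \<Rightarrow> real) \<Rightarrow> (real \<Rightarrow> real^'n \<Rightarrow> real) \<Rightarrow> real \<Rightarrow> real^'n \<Rightarrow> real" where
  "MO_adjoint T G J mt \<alpha> u f \<Lambda> t x =
     J (u t x) (mt x) + \<alpha> / 2 * (norm (u t x))\<^sup>2 - dt T (\<lambda>s. \<Lambda> s x) t
     - (LINT xh|lborel. (G x xh (u t x) \<bullet> gradient (\<Lambda> t) x
                         + G xh x (u t xh) \<bullet> gradient (\<Lambda> t) xh) * f t xh)"

definition MO_control ::
  "(real^'n \<Rightarrow> real^'n \<Rightarrow> real^'m \<Rightarrow> real^'n) \<Rightarrow> (real^'m \<Rightarrow> real^'n \<Rightarrow> real) \<Rightarrow>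
   (real^'n \<Rightarrow> real^'n) \<Rightarrow> real \<Rightarrow> (real \<Rightarrow> real^'n \<Rightarrow> real^'m) \<Rightarrow>
   (real \<Rightarrow> real^'n \<Rightarrow> real) \<Rightarrow> (real \<Rightarrow> real^'n \<Rightarrow> real) \<Rightarrow> real \<Rightarrow> real^'n \<Rightarrow> real^'m" where
  "MO_control G J mt \<alpha> u f \<Lambda> t x =
     grad_u J (u t x) (mt x) + \<alpha> *\<^sub>R u t x
     - (LINT xh|lborel. f t xh *\<^sub>R (transpose (Du G x xh (u t x)) *v gradient (\<Lambda> t) x))"

definition MO_system ::
  "real \<Rightarrow> (real^'n \<Rightarrow> real^'n \<Rightarrow> real^'m \<Rightarrow> real^'n) \<Rightarrow> (real^'m \<Rightarrow> real^'n \<Rightarrow> real) \<Rightarrow>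
   (real^'n \<Rightarrow> real^'n) \<Rightarrow> real \<Rightarrow> (real^'n \<Rightarrow> real) \<Rightarrow> (real \<Rightarrow> real^'n \<Rightarrow> real^'m) \<Rightarrow>
   (real \<Rightarrow> real^'n \<Rightarrow> real) \<Rightarrow> (real \<Rightarrow> real^'n \<Rightarrow> real) \<Rightarrow> bool" where
  "MO_system T G J mt \<alpha> f0 u f \<Lambda> \<longleftrightarrow>
     (\<forall>t\<in>{0..T}. \<forall>x. MO_continuity T G u f t x = 0) \<and>
     (\<forall>t\<in>{0..T}. \<forall>x. MO_adjoint T G J mt \<alpha> u f \<Lambda> t x = 0) \<and>
     (\<forall>t\<in>{0..T}. \<forall>x. MO_control G J mt \<alpha> u f \<Lambda> t x = 0) \<and>
     (\<forall>x. f 0 x = f0 x) \<and>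
     (\<forall>x. \<Lambda> T x = 0)"

text \<open>The same system with the adjoint equation and the terminal condition for \<open>\<Lambda>\<close> after
  application of the spatial gradient, and with the equations for \<open>\<Lambda>\<close> and \<open>u\<close> on the support of
  the density, where alone the identification determines the gradient of \<open>\<Lambda>\<close>.\<close>

definition MO_system_grad ::
  "real \<Rightarrow> (real^'n \<Rightarrow> real^'n \<Rightarrow> real^'m \<Rightarrow> real^'n) \<Rightarrow> (real^'m \<Rightarrow> real^'n \<Rightarrow> real) \<Rightarrow>
   (real^'n \<Rightarrow> real^'n) \<Rightarrow> real \<Rightarrow> (real^'n \<Rightarrow> real) \<Rightarrow> (real \<Rightarrow> real^'n \<Rightarrow> real^'m) \<Rightarrow>
   (real \<Rightarrow> real^'n \<Rightarrow> real) \<Rightarrow> (real \<Rightarrow> real^'n \<Rightarrow> real) \<Rightarrow> bool" where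
  "MO_system_grad T G J mt \<alpha> f0 u f \<Lambda> \<longleftrightarrow>
     (\<forall>t\<in>{0..T}. \<forall>x. MO_continuity T G u f t x = 0) \<and>
     (\<forall>t\<in>{0..T}. \<forall>x\<in>density_support f t. gradient (MO_adjoint T G J mt \<alpha> u f \<Lambda> t) x = 0) \<and>
     (\<forall>t\<in>{0..T}. \<forall>x\<in>density_support f t. MO_control G J mt \<alpha> u f \<Lambda> t x = 0) \<and>
     (\<forall>x. f 0 x = f0 x) \<and>
     (\<forall>x\<in>density_support f T. gradient (\<Lambda> T) x = 0)"

end

theory Submission
  imports Defs "HOL-Probability.Sinc_Integral"
begin

text \<open>Write \<open>V\<close> for the common velocity field and \<open>q = \<nabla>\<^sub>x\<Lambda>\<close>. The factorization and the
  identification say that the \<open>\<lambda>\<close>-moments of \<open>f\<^sup>O\<^sup>M\<close> of order 0 and 1 are \<open>f\<^sup>M\<^sup>O\<close> and \<open>- f\<^sup>M\<^sup>O q\<close>,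
  also off the support, where all of them vanish. Integrating the kinetic equation against \<open>1\<close> gives
  the continuity equation. Integrating it against \<open>\<lambda>\<close>, with integration by parts in \<open>\<lambda>\<close>, gives
  \<open>- q\<close> times the continuity equation plus \<open>f\<^sup>M\<^sup>O E\<close>. By the symmetry of second derivatives of
  \<open>\<Lambda>\<close>, the gradient of the adjoint equation is \<open>E\<close> plus the transposed Jacobian of \<open>u\<close> applied to
  the control equation. As \<open>E\<close> is continuous in \<open>x\<close>, it vanishes on the support of \<open>f\<^sup>M\<^sup>O\<close> iff
  \<open>f\<^sup>M\<^sup>O E\<close> vanishes everywhere. The averaged control equation is affine in \<open>\<lambda>\<close>, so its average is
  its value at \<open>\<lambda> = - q\<close>.\<close>

section \<open>Growth and decay\<close>

text \<open>Regularity and decay are assumed only for \<open>fOM\<close>: \<open>fMO\<close> enters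
  as a bare factor and \<nabla>\<Lambda> carries no growth bound. Two devices deal with this. Every
  nonlocal term of the mean-field system is rewritten by Fubini as an integral over the hatted state
  and multiplier against \<open>fOM\<close>, so that decay comes from \<open>fOM\<close> and the
  remaining factor depends on the data \<open>G\<close> and \<open>u\<close> and grows at most
  polynomially. And \<open>fMO\<close> and \<open>fMO\<close> times \<nabla>\<Lambda> are
  differentiated as moments of \<open>fOM\<close>, under the integral sign; comparing this with the
  product rule requires no division by \<open>fMO\<close>, which may vanish. Since time derivatives
  are one-sided at the ends of the horizon, differentiation under the integral, uniqueness of
  derivatives and symmetry of second derivatives are all needed on the slab
  \<open>{0..T} \<times> UNIV\<close> and not on an open set. Vector identities are tested against a
  direction \<open>e\<close>, and the test functions 1 and \<lambda> are merged into the affine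
  function \<open>c + l \<bullet> e\<close>.\<close>

lemma poly_growthE:
  assumes "poly_growth f"
  obtains C k where "C \<ge> 0" "\<And>z. norm (f z) \<le> C * (1 + norm z) ^ k"
proof -
  obtain C k where *: "\<And>z. norm (f z) \<le> C * (1 + norm z) ^ k"
    using assms unfolding poly_growth_def by blast
  moreover have "C \<ge> 0"
    using order_trans[OF norm_ge_zero *[of 0]] by simp
  ultimately show ?thesis
    using that by blast
qed

lemma poly_growthI: "(\<And>z. norm (f z) \<le> C * (1 + norm z) ^ k) \<Longrightarrow> poly_growth f"
  unfolding poly_growth_def by blast

lemma poly_growth_const: "poly_growth (\<lambda>_. c)"
  by (rule poly_growthI[of _ "norm c" 0]) simp

lemma poly_growth_ident: "poly_growth (\<lambda>z. z)"
  by (rule poly_growthI[of _ 1 1]) simp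

text \<open>Inner products, scalar multiplication, application and composition of bounded linear
  maps are all submultiplicative in norm, so this one estimate yields each of their closure rules;
  its additive counterpart yields those for sums and pairs.\<close>

lemma poly_growth_le_mult:
  assumes "poly_growth f" "poly_growth g" "\<And>z. norm (h z) \<le> norm (f z) * norm (g z)"
  shows "poly_growth h"
proof -
  obtain C k where f: "C \<ge> 0" "\<And>z. norm (f z) \<le> C * (1 + norm z) ^ k"
    using poly_growthE[OF assms(1)] by blast
  obtain D m where g: "D \<ge> 0" "\<And>z. norm (g z) \<le> D * (1 + norm z) ^ m"
    using poly_growthE[OF assms(2)] by blast
  show ?thesis
  proof (rule poly_growthI[of _ "C * D" "k + m"])
    fix z
    have "norm (h z) \<le> (C * (1 + norm z) ^ k) * (D * (1 + norm z) ^ m)"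
      using assms(3)[of z] by (rule order_trans) (intro mult_mono f g; simp add: f)
    then show "norm (h z) \<le> C * D * (1 + norm z) ^ (k + m)"
      by (simp add: power_add ac_simps)
  qed
qed

lemma poly_growth_le_add:
  assumes "poly_growth f" "poly_growth g" "\<And>z. norm (h z) \<le> norm (f z) + norm (g z)"
  shows "poly_growth h"
proof -
  obtain C k where f: "C \<ge> 0" "\<And>z. norm (f z) \<le> C * (1 + norm z) ^ k"
    using poly_growthE[OF assms(1)] by blast
  obtain D m where g: "D \<ge> 0" "\<And>z. norm (g z) \<le> D * (1 + norm z) ^ m"
    using poly_growthE[OF assms(2)] by blast
  show ?thesis
  proof (rule poly_growthI[of _ "C + D" "k + m"])
    fix z
    have "norm (h z) \<le> C * (1 + norm z) ^ k + D * (1 + norm z) ^ m"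
      using assms(3)[of z] f(2)[of z] g(2)[of z] by linarith
    also have "\<dots> \<le> C * (1 + norm z) ^ (k + m) + D * (1 + norm z) ^ (k + m)"
      by (intro add_mono mult_left_mono power_increasing f g) auto
    finally show "norm (h z) \<le> (C + D) * (1 + norm z) ^ (k + m)"
      by (simp add: algebra_simps)
  qed
qed

lemma poly_growth_le: "poly_growth f \<Longrightarrow> (\<And>z. norm (h z) \<le> norm (f z)) \<Longrightarrow> poly_growth h"
  by (rule poly_growth_le_mult[OF _ poly_growth_const[of "1::real"]]) auto

lemma poly_growth_add: "poly_growth f \<Longrightarrow> poly_growth g \<Longrightarrow> poly_growth (\<lambda>z. f z + g z)"
  by (rule poly_growth_le_add[of f g]) (auto intro: norm_triangle_ineq)

lemma poly_growth_Pair: "poly_growth f \<Longrightarrow> poly_growth g \<Longrightarrow> poly_growth (\<lambda>z. (f z, g z))"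
  by (rule poly_growth_le_add[of f g]) (auto intro: norm_Pair_le)

lemma poly_growth_fst: "poly_growth f \<Longrightarrow> poly_growth (\<lambda>z. fst (f z))"
  by (rule poly_growth_le[of f]) (auto simp: norm_prod_def)

lemma poly_growth_snd: "poly_growth f \<Longrightarrow> poly_growth (\<lambda>z. snd (f z))"
  by (rule poly_growth_le[of f]) (auto simp: norm_prod_def)

lemma poly_growth_inner: "poly_growth f \<Longrightarrow> poly_growth g \<Longrightarrow> poly_growth (\<lambda>z. f z \<bullet> g z)"
  by (rule poly_growth_le_mult[of f g]) (auto simp: Cauchy_Schwarz_ineq2)

lemma poly_growth_mult:
  fixes f g :: "_ \<Rightarrow> 'b::real_normed_algebra"
  shows "poly_growth f \<Longrightarrow> poly_growth g \<Longrightarrow> poly_growth (\<lambda>z. f z * g z)"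
  by (rule poly_growth_le_mult[of f g]) (auto simp: norm_mult_ineq)

lemma poly_growth_scaleR: "poly_growth f \<Longrightarrow> poly_growth g \<Longrightarrow> poly_growth (\<lambda>z. f z *\<^sub>R g z)"
  by (rule poly_growth_le_mult[of f g]) auto

lemma poly_growth_blinfun_apply:
  "poly_growth f \<Longrightarrow> poly_growth g \<Longrightarrow> poly_growth (\<lambda>z. blinfun_apply (f z) (g z))"
  by (rule poly_growth_le_mult[of f g]) (auto simp: norm_blinfun)

lemma poly_growth_blinfun_compose:
  "poly_growth f \<Longrightarrow> poly_growth g \<Longrightarrow> poly_growth (\<lambda>z. f z o\<^sub>L g z)"
  by (rule poly_growth_le_mult[of f g]) (auto simp: norm_blinfun_compose)

lemma poly_growth_compose:
  fixes f :: "'b::real_normed_vector \<Rightarrow> 'c::real_normed_vector"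
    and g :: "'a::real_normed_vector \<Rightarrow> 'b"
  assumes "poly_growth f" "poly_growth g"
  shows "poly_growth (\<lambda>z. f (g z))"
proof -
  obtain C k where f: "C \<ge> 0" "\<And>z. norm (f z) \<le> C * (1 + norm z) ^ k"
    using poly_growthE[OF assms(1)] by blast
  obtain D m where g: "D \<ge> 0" "\<And>z. norm (g z) \<le> D * (1 + norm z) ^ m"
    using poly_growthE[OF assms(2)] by blast
  show ?thesis
  proof (rule poly_growthI[of _ "C * (1 + D) ^ k" "m * k"])
    fix z :: 'a
    have "1 \<le> (1 + norm z) ^ m"
      by (rule one_le_power) simp
    then have "1 + norm (g z) \<le> (1 + D) * (1 + norm z) ^ m"
      using g(2)[of z] unfolding distrib_right by linarith
    then have "(1 + norm (g z)) ^ k \<le> ((1 + D) * (1 + norm z) ^ m) ^ k"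
      by (intro power_mono) auto
    then have "C * (1 + norm (g z)) ^ k \<le> C * ((1 + D) * (1 + norm z) ^ m) ^ k"
      using f by (intro mult_left_mono)
    with f(2)[of "g z"] show "norm (f (g z)) \<le> C * (1 + D) ^ k * (1 + norm z) ^ (m * k)"
      unfolding power_mult_distrib power_mult mult.assoc by linarith
  qed
qed

lemmas poly_growth_intros =
  poly_growth_const poly_growth_ident poly_growth_add poly_growth_Pair poly_growth_fst
  poly_growth_snd poly_growth_inner poly_growth_mult poly_growth_scaleR poly_growth_blinfun_apply
  poly_growth_blinfun_compose

section \<open>Rapid decay at a fixed time and an integrable majorant\<close>

definition rapid_decay :: "('a::real_normed_vector \<Rightarrow> 'b::real_normed_vector) \<Rightarrow> bool" where
  "rapid_decay f \<longleftrightarrow> (\<forall>k. \<exists>C. \<forall>z. (1 + norm z) ^ k * norm (f z) \<le> C)"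

lemma rapid_decay_le_mult:
  assumes "rapid_decay f" "poly_growth g" "\<And>z. norm (h z) \<le> norm (f z) * norm (g z)"
  shows "rapid_decay h"
  unfolding rapid_decay_def
proof
  fix k
  obtain D m where g: "D \<ge> 0" "\<And>z. norm (g z) \<le> D * (1 + norm z) ^ m"
    using poly_growthE[OF assms(2)] by blast
  obtain C where f: "\<And>z. (1 + norm z) ^ (k + m) * norm (f z) \<le> C"
    using assms(1) unfolding rapid_decay_def by blast
  show "\<exists>C. \<forall>z. (1 + norm z) ^ k * norm (h z) \<le> C"
  proof (intro exI allI)
    fix z
    have "(1 + norm z) ^ k * norm (h z) \<le> (1 + norm z) ^ k * (norm (f z) * (D * (1 + norm z) ^ m))"
      using assms(3)[of z] by (intro mult_left_mono order_trans[OF assms(3)] g) auto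
    also have "\<dots> = D * ((1 + norm z) ^ (k + m) * norm (f z))"
      by (simp add: power_add)
    also have "\<dots> \<le> D * C"
      using f g by (intro mult_left_mono)
    finally show "(1 + norm z) ^ k * norm (h z) \<le> D * C" .
  qed
qed

lemma rapid_decay_scaleR: "rapid_decay f \<Longrightarrow> poly_growth g \<Longrightarrow> rapid_decay (\<lambda>z. f z *\<^sub>R g z)"
  by (rule rapid_decay_le_mult[of f g]) auto

lemma rapid_decay_add: 
  assumes "rapid_decay f" "rapid_decay g"
  shows "rapid_decay (\<lambda>z. f z + g z)"
  unfolding rapid_decay_def
proof
  fix k
  obtain C D where "\<And>z. (1 + norm z) ^ k * norm (f z) \<le> C" "\<And>z. (1 + norm z) ^ k * norm (g z) \<le> D"
    using assms unfolding rapid_decay_def by metis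
  moreover have "(1 + norm z) ^ k * norm (f z + g z)
      \<le> (1 + norm z) ^ k * norm (f z) + (1 + norm z) ^ k * norm (g z)" for z
    unfolding distrib_left[symmetric] by (intro mult_left_mono norm_triangle_ineq) auto
  ultimately have "(1 + norm z) ^ k * norm (f z + g z) \<le> C + D" for z
    by (meson add_mono order_trans)
  then show "\<exists>C. \<forall>z. (1 + norm z) ^ k * norm (f z + g z) \<le> C"
    by blast
qed

lemma nn_integral_inverse_1_plus_square: "(\<integral>\<^sup>+x. ennreal (inverse (1 + (x::real)\<^sup>2)) \<partial>lborel) < \<infinity>"
proof -
  have "integrable lborel (\<lambda>x::real. inverse (1 + x\<^sup>2))"
    using integrable_inverse_1_plus_square by (simp add: set_integrable_def einterval_def)
  then show ?thesis
    by (simp add: integrable_iff_bounded)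
qed

text \<open>The exponent spends two powers on each coordinate: \<open>(1 + norm z)\<^sup>2\<close>
  dominates \<open>1 + (z \<bullet> b)\<^sup>2\<close> for every basis vector \<open>b\<close>, so
  the weight lies below a product of one-dimensional functions with finite integral.\<close>

definition decay_weight :: "'a::euclidean_space \<Rightarrow> real" where
  "decay_weight z = inverse ((1 + norm z) ^ (2 * DIM('a)))"

lemma decay_weight_nonneg: "decay_weight z \<ge> 0"
  by (simp add: decay_weight_def)

text \<open>The comparison function is a product over the coordinates, so its integral factorizes
  into copies of the integral of \<open>inverse (1 + x\<^sup>2)\<close>.\<close>

lemma integrable_decay_weight:
  "integrable lborel (decay_weight :: 'a::euclidean_space \<Rightarrow> real)"
proof (rule integrableI_bounded)
  show "(decay_weight :: 'a \<Rightarrow> real) \<in> borel_measurable lborel"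
    unfolding decay_weight_def by measurable
  have le: "ennreal (norm (decay_weight z)) \<le> (\<Prod>b\<in>Basis. ennreal (inverse (1 + (z \<bullet> b)\<^sup>2)))" for z :: 'a
  proof -
    have "(\<Prod>b\<in>(Basis::'a set). 1 + (z \<bullet> b)\<^sup>2) \<le> (\<Prod>b\<in>(Basis::'a set). (1 + norm z)\<^sup>2)"
    proof (intro prod_mono conjI)
      fix b :: 'a assume "b \<in> Basis"
      then have "(z \<bullet> b)\<^sup>2 \<le> (norm z)\<^sup>2"
        using Basis_le_norm[of b z] abs_le_square_iff[of "z \<bullet> b" "norm z"] by simp
      then show "1 + (z \<bullet> b)\<^sup>2 \<le> (1 + norm z)\<^sup>2"
        by (simp add: power2_sum add.commute add_increasing)
    qed auto
    then have "inverse ((1 + norm z) ^ (2 * DIM('a))) \<le> inverse (\<Prod>b\<in>(Basis::'a set). 1 + (z \<bullet> b)\<^sup>2)"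
      by (intro le_imp_inverse_le prod_pos) (auto simp: power_mult intro: add_pos_nonneg)
    then have "decay_weight z \<le> (\<Prod>b\<in>Basis. inverse (1 + (z \<bullet> b)\<^sup>2))"
      unfolding decay_weight_def by (simp only: prod_inversef[unfolded comp_def])
    then show ?thesis
      using decay_weight_nonneg[of z] by (subst prod_ennreal) (auto intro!: ennreal_leI)
  qed
  have "(\<integral>\<^sup>+z. ennreal (norm (decay_weight (z::'a))) \<partial>lborel)
      \<le> (\<integral>\<^sup>+z. (\<Prod>b\<in>Basis. ennreal (inverse (1 + ((z::'a) \<bullet> b)\<^sup>2))) \<partial>lborel)"
    by (intro nn_integral_mono le)
  also have "\<dots> = (\<Prod>b\<in>(Basis::'a set). \<integral>\<^sup>+x. ennreal (inverse (1 + x\<^sup>2)) \<partial>lborel)"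
    by (rule nn_integral_lborel_prod) auto
  also have "\<dots> < \<infinity>"
    using nn_integral_inverse_1_plus_square by (simp add: power_less_top_ennreal)
  finally show "(\<integral>\<^sup>+z. ennreal (norm (decay_weight (z::'a))) \<partial>lborel) < \<infinity>" .
qed

text \<open>Trades \<open>2 * DIM('a)\<close> powers of decay for an integrable factor; the other
  \<open>k\<close> powers stay available to absorb polynomial growth.\<close>

lemma decay_weight_bound:
  fixes z :: "'a::euclidean_space"
  assumes "(1 + norm z) ^ (k + 2 * DIM('a)) * r \<le> C"
  shows "(1 + norm z) ^ k * r \<le> C * decay_weight z"
proof -
  have "0 < (1 + norm z) ^ (2 * DIM('a))"
    by (intro zero_less_power add_pos_nonneg) auto
  then show ?thesis
    using assms by (simp add: decay_weight_def power_add field_simps)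
qed

lemma rapid_decay_le_weight:
  fixes f :: "'a::euclidean_space \<Rightarrow> 'b::real_normed_vector"
  assumes "rapid_decay f"
  obtains C where "\<And>z. norm (f z) \<le> C * decay_weight z"
proof -
  obtain C where "\<And>z. (1 + norm z) ^ (2 * DIM('a)) * norm (f z) \<le> C"
    using assms unfolding rapid_decay_def by blast
  then show ?thesis
    using decay_weight_bound[of "_::'a" 0] that[of C] by simp
qed

lemma integrable_rapid_decay:
  fixes f :: "'a::euclidean_space \<Rightarrow> 'b::{banach, second_countable_topology}"
  assumes "rapid_decay f" "f \<in> borel_measurable borel"
  shows "integrable lborel f"
proof -
  obtain C where C: "\<And>z. norm (f z) \<le> C * decay_weight z"
    using rapid_decay_le_weight[OF assms(1)] by blast
  show ?thesis
    using assms(2) order_trans[OF C abs_ge_self]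
    by (intro Bochner_Integration.integrable_bound[OF integrable_mult_right[OF integrable_decay_weight, of C]])
       auto
qed

lemma integrable_rapid_decay_scaleR:
  fixes \<Psi> :: "'z::euclidean_space \<Rightarrow> 'b::{banach, second_countable_topology}"
  assumes "rapid_decay a" "continuous_on UNIV a" "poly_growth \<Psi>" "continuous_on UNIV \<Psi>"
  shows "integrable lborel (\<lambda>z. a z *\<^sub>R \<Psi> z)"
  using assms
  by (intro integrable_rapid_decay rapid_decay_scaleR borel_measurable_continuous_onI
      continuous_intros)


section \<open>Parameter integrals\<close>

text \<open>Dominated convergence for the remainder of the linear approximation divided by the
  increment. The derivative is taken within a convex set, which covers both small balls and the slab
  \<open>{0..T} \<times> UNIV\<close> with its end points.\<close>

lemma has_derivative_integral_dominated:
  fixes F :: "'x::real_normed_vector \<Rightarrow> 'z \<Rightarrow> 'b::{banach, second_countable_topology}"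
    and F' :: "'x \<Rightarrow> 'z \<Rightarrow> 'x \<Rightarrow>\<^sub>L 'b"
  assumes X: "convex X" "x \<in> X"
    and der: "\<And>x z. x \<in> X \<Longrightarrow> ((\<lambda>x. F x z) has_derivative F' x z) (at x within X)"
    and int: "\<And>x. x \<in> X \<Longrightarrow> integrable M (F x)"
    and meas: "\<And>h. (\<lambda>z. F' x z h) \<in> borel_measurable M"
    and bound: "\<And>x z. x \<in> X \<Longrightarrow> norm (F' x z) \<le> g z"
    and g: "integrable M g"
  shows "((\<lambda>x. \<integral>z. F x z \<partial>M) has_derivative (\<lambda>h. \<integral>z. F' x z h \<partial>M)) (at x within X)"
proof -
  have bound_apply: "norm (F' x z h) \<le> norm h * g z" for z h
    using norm_blinfun[of "F' x z" h] bound[OF X(2), of z]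
    by (smt (verit) mult.commute mult_left_mono norm_ge_zero)
  have g_nonneg: "0 \<le> g z" for z
    using order_trans[OF norm_ge_zero bound[OF X(2)]] .
  have int': "integrable M (\<lambda>z. F' x z h)" for h
    using bound_apply[of _ h] g_nonneg
    by (intro Bochner_Integration.integrable_bound[OF integrable_mult_right[OF g, of "norm h"] meas]) auto
  have lin: "bounded_linear (\<lambda>h. \<integral>z. F' x z h \<partial>M)"
  proof (rule bounded_linear_intro)
    show "norm (\<integral>z. F' x z h \<partial>M) \<le> norm h * (\<integral>z. g z \<partial>M)" for h
    proof -
      have "norm (\<integral>z. F' x z h \<partial>M) \<le> (\<integral>z. norm h * g z \<partial>M)"
        by (rule order_trans[OF integral_norm_bound integral_mono]) (use int' g bound_apply in auto)
      then show ?thesis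
        by simp
    qed
  qed (simp_all add: blinfun.add_right blinfun.scaleR_right int')
  define R where "R y z = (1 / norm (y - x)) *\<^sub>R (F y z - (F x z + F' x z (y - x)))" for y z
  \<comment> \<open>Along the segment from \<open>x\<close> to \<open>y\<close>, which stays in the
    convex set, the mean value inequality bounds the increment by \<open>g z\<close> times its
    length; the linear part contributes the second \<open>g z\<close>.\<close>
  have R_bound: "norm (R y z) \<le> 2 * g z" if "y \<in> X" for y z
  proof -
    have "norm (F y z - F x z) \<le> g z * norm (y - x)"
      by (rule differentiable_bound[OF X(1) der _ that X(2)]) (use bound in \<open>auto simp: norm_blinfun.rep_eq\<close>)
    moreover have "norm (F' x z (y - x)) \<le> g z * norm (y - x)"
      using bound_apply[of z "y - x"] by (simp add: mult.commute)
    ultimately have "norm (F y z - (F x z + F' x z (y - x))) \<le> 2 * g z * norm (y - x)"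
      using norm_triangle_ineq4[of "F y z - F x z" "F' x z (y - x)"] by (simp add: algebra_simps)
    then show ?thesis
      using g_nonneg[of z] by (cases "y = x") (auto simp: R_def divide_simps)
  qed
  have "((\<lambda>y. \<integral>z. R y z \<partial>M) \<longlongrightarrow> 0) (at x within X)"
    unfolding tendsto_at_iff_sequentially comp_def
  proof (intro allI impI)
    fix Y assume Y: "\<forall>i. Y i \<in> X - {x}" "Y \<longlonglongrightarrow> x"
    have "(\<lambda>i. \<integral>z. R (Y i) z \<partial>M) \<longlonglongrightarrow> (\<integral>z. 0 \<partial>M)"
    proof (rule integral_dominated_convergence)
      show "integrable M (\<lambda>z. 2 * g z)"
        using g by simp
      show "R (Y i) \<in> borel_measurable M" for i
        using borel_measurable_integrable[OF int[of "Y i"]] borel_measurable_integrable[OF int[OF X(2)]]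
          meas[of "Y i - x"] Y(1) unfolding R_def by auto
      have "(\<lambda>i. R (Y i) z) \<longlonglongrightarrow> 0" for z
        using der[OF X(2), of z] Y unfolding has_derivative_within R_def tendsto_at_iff_sequentially comp_def
        by blast
      then show "AE z in M. (\<lambda>i. R (Y i) z) \<longlonglongrightarrow> 0"
        by simp
    qed (use R_bound Y in auto)
    then show "(\<lambda>i. \<integral>z. R (Y i) z \<partial>M) \<longlonglongrightarrow> 0"
      by simp
  qed
  moreover have "(\<integral>z. R y z \<partial>M)
      = (1 / norm (y - x)) *\<^sub>R ((\<integral>z. F y z \<partial>M) - ((\<integral>z. F x z \<partial>M) + (\<integral>z. F' x z (y - x) \<partial>M)))"
    if "y \<in> X" for y
    using int[OF that] int[OF X(2)] int' by (simp add: R_def)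
  ultimately have "((\<lambda>y. (1 / norm (y - x)) *\<^sub>R ((\<integral>z. F y z \<partial>M) - ((\<integral>z. F x z \<partial>M) + (\<integral>z. F' x z (y - x) \<partial>M))))
      \<longlongrightarrow> 0) (at x within X)"
    by - (erule Lim_transform_eventually, simp add: eventually_at_filter)
  then show ?thesis
    unfolding has_derivative_within using lin by simp
qed

lemma continuous_on_integral_dominated:
  fixes F :: "'x::first_countable_topology \<Rightarrow> 'z \<Rightarrow> 'b::{banach, second_countable_topology}"
  assumes "\<And>z. continuous_on X (\<lambda>x. F x z)"
    and "\<And>x. x \<in> X \<Longrightarrow> F x \<in> borel_measurable M"
    and "\<And>x z. x \<in> X \<Longrightarrow> norm (F x z) \<le> g z"
    and "integrable M g"
  shows "continuous_on X (\<lambda>x. \<integral>z. F x z \<partial>M)"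
  unfolding continuous_on_def tendsto_at_iff_sequentially comp_def
proof (intro ballI allI impI)
  fix x Y assume x: "x \<in> X" and Y: "\<forall>i. Y i \<in> X - {x}" "Y \<longlonglongrightarrow> x"
  show "(\<lambda>i. \<integral>z. F (Y i) z \<partial>M) \<longlonglongrightarrow> (\<integral>z. F x z \<partial>M)"
  proof (rule integral_dominated_convergence[OF _ _ assms(4)])
    show "AE z in M. (\<lambda>i. F (Y i) z) \<longlonglongrightarrow> F x z"
      using assms(1) x Y unfolding continuous_on_def tendsto_at_iff_sequentially comp_def by auto
  qed (use assms x Y in auto)
qed

text \<open>Joint polynomial growth admits no majorant uniform in all parameters, but continuity and
  differentiability are local. On a unit ball the parameter is bounded by a constant
  \<open>R\<close>, and \<open>1 + norm (x, z) \<le> (1 + R) * (1 + norm z)\<close> moves all growth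
  to \<open>z\<close>, where the decay of \<open>a\<close> absorbs it.\<close>

lemma locally_dominated_by_weight:
  fixes \<Psi> :: "'x::real_normed_vector \<times> 'z::euclidean_space \<Rightarrow> 'b::real_normed_vector"
  assumes "rapid_decay a" "poly_growth \<Psi>"
  obtains C where "\<And>x z. x \<in> ball x0 1 \<Longrightarrow> \<bar>a z\<bar> * norm (\<Psi> (x, z)) \<le> C * decay_weight z"
proof -
  define R where "R = norm x0 + 1"
  have R: "R \<ge> 0"
    by (simp add: R_def)
  obtain C k where \<Psi>: "C \<ge> 0" "\<And>y. norm (\<Psi> y) \<le> C * (1 + norm y) ^ k"
    using poly_growthE[OF assms(2)] by blast
  obtain D where a: "\<And>z. (1 + norm z) ^ (k + 2 * DIM('z)) * \<bar>a z\<bar> \<le> D"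
    using assms(1) unfolding rapid_decay_def by (metis real_norm_def)
  show ?thesis
  proof
    fix x :: 'x and z :: 'z assume "x \<in> ball x0 1"
    then have "norm x \<le> R"
      using norm_triangle_ineq2[of x x0] by (simp add: R_def dist_norm norm_minus_commute)
    then have "norm (x, z) \<le> R + norm z"
      using norm_Pair_le[of x z] by linarith
    moreover have "0 \<le> R * norm z"
      using R by simp
    ultimately have "1 + norm (x, z) \<le> (1 + R) * (1 + norm z)"
      by (simp add: algebra_simps)
    then have "(1 + norm (x, z)) ^ k \<le> ((1 + R) * (1 + norm z)) ^ k"
      by (intro power_mono) auto
    then have "norm (\<Psi> (x, z)) \<le> C * ((1 + R) ^ k * (1 + norm z) ^ k)"
      using \<Psi>(2)[of "(x, z)"] \<Psi>(1) by (simp add: power_mult_distrib) (meson mult_left_mono order_trans)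
    then have "\<bar>a z\<bar> * norm (\<Psi> (x, z)) \<le> \<bar>a z\<bar> * (C * ((1 + R) ^ k * (1 + norm z) ^ k))"
      by (intro mult_left_mono) auto
    also have "\<dots> = C * (1 + R) ^ k * ((1 + norm z) ^ k * \<bar>a z\<bar>)"
      by simp
    also have "\<dots> \<le> C * (1 + R) ^ k * (D * decay_weight z)"
      using \<Psi>(1) R by (intro mult_left_mono decay_weight_bound a) auto
    finally show "\<bar>a z\<bar> * norm (\<Psi> (x, z)) \<le> C * (1 + R) ^ k * D * decay_weight z"
      by (simp add: mult.assoc)
  qed
qed

lemma continuous_on_slice:
  "continuous_on UNIV \<Psi> \<Longrightarrow> continuous_on X (\<lambda>z. \<Psi> (x, z))"
  "continuous_on UNIV \<Psi> \<Longrightarrow> continuous_on Y (\<lambda>x. \<Psi> (x, z))"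
  by (rule continuous_on_compose2[of UNIV \<Psi>]; auto intro!: continuous_intros)+

lemma poly_growth_slice: "poly_growth \<Psi> \<Longrightarrow> poly_growth (\<lambda>z. \<Psi> (x, z))"
  by (rule poly_growth_compose[OF _ poly_growth_Pair[OF poly_growth_const poly_growth_ident]])

lemma continuous_on_weighted_integral:
  fixes \<Psi> :: "'x::real_normed_vector \<times> 'z::euclidean_space \<Rightarrow> 'b::{banach, second_countable_topology}"
  assumes a: "rapid_decay a" "continuous_on UNIV a"
    and \<Psi>: "poly_growth \<Psi>" "continuous_on UNIV \<Psi>"
  shows "continuous_on UNIV (\<lambda>x. LINT z|lborel. a z *\<^sub>R \<Psi> (x, z))"
  unfolding continuous_on_eq_continuous_at[OF open_UNIV]
proof
  fix x0 :: 'x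
  obtain C where C: "\<And>x z. x \<in> ball x0 1 \<Longrightarrow> \<bar>a z\<bar> * norm (\<Psi> (x, z)) \<le> C * decay_weight z"
    using locally_dominated_by_weight[OF a(1) \<Psi>(1)] by metis
  have "continuous_on (ball x0 1) (\<lambda>x. LINT z|lborel. a z *\<^sub>R \<Psi> (x, z))"
  proof (rule continuous_on_integral_dominated)
    show "integrable lborel (\<lambda>z. C * decay_weight z)"
      by (intro integrable_mult_right integrable_decay_weight)
    show "(\<lambda>z. a z *\<^sub>R \<Psi> (x, z)) \<in> borel_measurable lborel" for x
      using borel_measurable_continuous_onI[OF a(2)] borel_measurable_continuous_onI[OF continuous_on_slice(1)[OF \<Psi>(2), of UNIV x]]
      by auto
  qed (use C in \<open>auto intro!: continuous_intros continuous_on_slice(2)[OF \<Psi>(2)]\<close>)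
  then show "isCont (\<lambda>x. LINT z|lborel. a z *\<^sub>R \<Psi> (x, z)) x0"
    by (simp add: continuous_on_eq_continuous_at)
qed

lemma has_derivative_weighted_integral:
  fixes \<Phi> :: "'x::real_normed_vector \<times> 'z::euclidean_space \<Rightarrow> 'b::{banach, second_countable_topology}"
    and \<Phi>' :: "'x \<times> 'z \<Rightarrow> 'x \<Rightarrow>\<^sub>L 'b"
  assumes a: "rapid_decay a" "continuous_on UNIV a"
    and \<Phi>: "poly_growth \<Phi>" "continuous_on UNIV \<Phi>"
    and \<Phi>': "poly_growth \<Phi>'" "continuous_on UNIV \<Phi>'"
    and der: "\<And>x z. ((\<lambda>x. \<Phi> (x, z)) has_derivative \<Phi>' (x, z)) (at x)"
  shows "((\<lambda>x. LINT z|lborel. a z *\<^sub>R \<Phi> (x, z)) has_derivative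
      (\<lambda>h. LINT z|lborel. a z *\<^sub>R \<Phi>' (x, z) h)) (at x)"
proof -
  obtain C where C: "\<And>y z. y \<in> ball x 1 \<Longrightarrow> \<bar>a z\<bar> * norm (\<Phi>' (y, z)) \<le> C * decay_weight z"
    using locally_dominated_by_weight[OF a(1) \<Phi>'(1)] by metis
  have "((\<lambda>x. LINT z|lborel. a z *\<^sub>R \<Phi> (x, z)) has_derivative
      (\<lambda>h. LINT z|lborel. (a z *\<^sub>R \<Phi>' (x, z)) h)) (at x within ball x 1)"
  proof (rule has_derivative_integral_dominated)
    show "((\<lambda>x. a z *\<^sub>R \<Phi> (x, z)) has_derivative (a z *\<^sub>R \<Phi>' (y, z))) (at y within ball x 1)" for y z
      using has_derivative_scaleR_right[OF has_derivative_at_withinI[OF der[of z y]]]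
      by (simp add: scaleR_blinfun.rep_eq)
    show "integrable lborel (\<lambda>z. a z *\<^sub>R \<Phi> (y, z))" for y
      by (rule integrable_rapid_decay_scaleR[OF a poly_growth_slice[OF \<Phi>(1)] continuous_on_slice(1)[OF \<Phi>(2)]])
    show "(\<lambda>z. (a z *\<^sub>R \<Phi>' (x, z)) h) \<in> borel_measurable lborel" for h
      by (simp add: scaleR_blinfun.rep_eq,
          intro borel_measurable_continuous_onI continuous_on_scaleR a(2) blinfun.continuous_on
            continuous_on_const, rule continuous_on_slice(1)[OF \<Phi>'(2)])
    show "integrable lborel (\<lambda>z. C * decay_weight z)"
      by (intro integrable_mult_right integrable_decay_weight)
      show "norm (a z *\<^sub>R \<Phi>' (y, z)) \<le> C * decay_weight z" if "y \<in> ball x 1" for y z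
      using C[OF that, of z] by simp
  qed auto
  then show ?thesis
    by (simp add: at_within_open[OF _ open_ball] scaleR_blinfun.rep_eq)
qed

text \<open>By translation invariance of Lebesgue measure the integral of
  \<open>\<phi> (x + s *\<^sub>R h)\<close> over \<open>x\<close> does not depend on
  \<open>s\<close>; differentiating under the integral at \<open>s = 0\<close> gives the claim,
  without boundary terms or iterated integrals.\<close>

lemma integral_directional_derivative_eq_0:
  fixes \<phi> :: "'a::euclidean_space \<Rightarrow> real"
  assumes der: "\<And>x. (\<phi> has_derivative \<phi>' x) (at x)"
    and \<phi>: "rapid_decay \<phi>"
    and \<phi>': "rapid_decay (\<lambda>x. \<phi>' x h)" "continuous_on UNIV (\<lambda>x. \<phi>' x h)"
  shows "(LINT x|lborel. \<phi>' x h) = 0"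
proof -
  have cont: "continuous_on UNIV \<phi>"
    using der by (meson has_derivative_continuous continuous_at_imp_continuous_on)
  obtain C where C: "\<And>x. (1 + norm x) ^ (2 * DIM('a)) * norm (\<phi>' x h) \<le> C"
    using \<phi>'(1) unfolding rapid_decay_def by blast
  \<comment> \<open>A shift by \<open>s *\<^sub>R h\<close> with \<bar>s\<bar> < 1 changes
    \<open>1 + norm x\<close> by a factor of at most \<open>1 + norm h\<close>, once for each of the
    \<open>2 * DIM('a)\<close> powers.\<close>
  define D where "D = (1 + norm h) ^ (2 * DIM('a)) * C"
  have bound: "norm (\<phi>' (x + s *\<^sub>R h) h) \<le> D * decay_weight x" if "s \<in> ball 0 1" for x s
  proof -
    have "norm (s *\<^sub>R h) \<le> norm h"
      using that by (simp add: mult_left_le_one_le)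
    then have "norm x \<le> norm (x + s *\<^sub>R h) + norm h"
      using norm_triangle_ineq4[of "x + s *\<^sub>R h" "s *\<^sub>R h"] by simp
    moreover have "0 \<le> norm h * norm (x + s *\<^sub>R h)"
      by (rule mult_nonneg_nonneg) auto
    ultimately have "1 + norm x \<le> (1 + norm h) * (1 + norm (x + s *\<^sub>R h))"
      unfolding distrib_left distrib_right by linarith
    then have "(1 + norm x) ^ (2 * DIM('a)) \<le> ((1 + norm h) * (1 + norm (x + s *\<^sub>R h))) ^ (2 * DIM('a))"
      by (intro power_mono) auto
    then have "(1 + norm x) ^ (2 * DIM('a)) * norm (\<phi>' (x + s *\<^sub>R h) h)
        \<le> (1 + norm h) ^ (2 * DIM('a)) * ((1 + norm (x + s *\<^sub>R h)) ^ (2 * DIM('a)) * norm (\<phi>' (x + s *\<^sub>R h) h))"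
      by (metis (no_types) mult.assoc mult_right_mono norm_ge_zero power_mult_distrib)
    also have "\<dots> \<le> D"
      unfolding D_def by (intro mult_left_mono C) auto
    finally show ?thesis
      using decay_weight_bound[of x 0] by simp
  qed
  have shift: "(LINT x|lborel. \<phi> (x + s *\<^sub>R h)) = (LINT x|lborel. \<phi> x)" for s
    by (subst (2) lborel_distr_plus[of "s *\<^sub>R h", symmetric], subst integral_distr)
       (auto simp: add.commute intro: borel_measurable_continuous_onI[OF cont])
  have "((\<lambda>s. LINT x|lborel. \<phi> (x + s *\<^sub>R h)) has_derivative
      (\<lambda>r. LINT x|lborel. blinfun_scaleR_left (\<phi>' (x + 0 *\<^sub>R h) h) r)) (at 0 within ball (0::real) 1)"
  proof (rule has_derivative_integral_dominated)
    show "((\<lambda>s. \<phi> (x + s *\<^sub>R h)) has_derivative (blinfun_scaleR_left (\<phi>' (x + s *\<^sub>R h) h))) (at s within ball 0 1)"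
      for s x
    proof -
      have "((\<lambda>s. \<phi> (x + s *\<^sub>R h)) has_derivative (\<lambda>r. \<phi>' (x + s *\<^sub>R h) (r *\<^sub>R h))) (at s within ball 0 1)"
        by (rule has_derivative_compose[OF _ der]) (auto intro!: derivative_eq_intros)
      then show ?thesis
        by (simp add: linear_scale[OF has_derivative_linear[OF der]])
    qed
    show "integrable lborel (\<lambda>x. \<phi> (x + s *\<^sub>R h))" for s
    proof -
      have "integrable (distr lborel borel ((+) (s *\<^sub>R h))) \<phi>"
        unfolding lborel_distr_plus
        by (intro integrable_rapid_decay \<phi> borel_measurable_continuous_onI cont)
      moreover have "(+) (s *\<^sub>R h) \<in> lborel \<rightarrow>\<^sub>M borel" "\<phi> \<in> borel_measurable borel"
        by (auto intro: borel_measurable_continuous_onI[OF cont])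
      ultimately show ?thesis
        by (simp add: integrable_distr_eq add.commute[of _ "s *\<^sub>R h"])
    qed
    show "(\<lambda>x. blinfun_scaleR_left (\<phi>' (x + 0 *\<^sub>R h) h) r) \<in> borel_measurable lborel" for r
      using borel_measurable_continuous_onI[OF \<phi>'(2)] by simp
    show "integrable lborel (\<lambda>x. D * decay_weight x :: real)"
      by (intro integrable_mult_right integrable_decay_weight)
    show "norm (blinfun_scaleR_left (\<phi>' (x + s *\<^sub>R h) h)) \<le> D * decay_weight x" if "s \<in> ball 0 1" for s x
    proof (rule norm_blinfun_bound)
      show "0 \<le> D * decay_weight x"
        using order_trans[OF norm_ge_zero bound[OF that]] .
      show "norm (blinfun_scaleR_left (\<phi>' (x + s *\<^sub>R h) h) r) \<le> D * decay_weight x * norm r" for r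
        using mult_left_mono[OF bound[OF that, of x], of "norm r"]
        by (simp add: abs_mult mult.commute[of _ "\<bar>r\<bar>"])
    qed
  qed auto
  then have "((\<lambda>s::real. LINT x|lborel. \<phi> x) has_derivative (\<lambda>r. (LINT x|lborel. r * \<phi>' x h))) (at 0)"
    unfolding shift by (simp add: at_within_open[OF _ open_ball])
  then have "(\<lambda>r. (LINT x|lborel. r * \<phi>' x h)) = (\<lambda>r. 0)"
    by (rule has_derivative_unique) simp
  from fun_cong[OF this, of 1] show ?thesis
    by simp
qed

lemma lborel_integral_pair:
  fixes g :: "'a::euclidean_space \<times> 'b::euclidean_space \<Rightarrow> 'c::{banach, second_countable_topology}"
  assumes "integrable lborel g"
  shows "integrable lborel (\<lambda>x. LINT y|lborel. g (x, y))"
    and "(LINT z|lborel. g z) = (LINT x|lborel. LINT y|lborel. g (x, y))"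
proof -
  have g: "integrable (lborel \<Otimes>\<^sub>M lborel) g"
    using assms by (simp add: lborel_prod)
  show "integrable lborel (\<lambda>x. LINT y|lborel. g (x, y))"
    using lborel_pair.integrable_fst'[OF g] .
  show "(LINT z|lborel. g z) = (LINT x|lborel. LINT y|lborel. g (x, y))"
    using lborel_pair.integral_fst'[OF g] by (simp add: lborel_prod)
qed

lemma poly_growth_sum:
  "(\<And>i. i \<in> I \<Longrightarrow> poly_growth (f i)) \<Longrightarrow> poly_growth (\<lambda>z. \<Sum>i\<in>I. f i z)"
  by (induction I rule: infinite_finite_induct) (auto intro: poly_growth_intros)


section \<open>Differential operators\<close>

text \<open>The gradient is a definite description, so existence and uniqueness must both be
  supplied: the candidate is the Riesz vector assembled from the values of \<open>f'\<close> on the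
  basis. Later arguments use the gradient only through such inner products.\<close>

lemma gradient_inner:
  fixes f :: "'a::euclidean_space \<Rightarrow> real"
  assumes "(f has_derivative f') (at x)"
  shows "gradient f x \<bullet> h = f' h"
proof -
  define D where "D = (\<Sum>b\<in>Basis. f' b *\<^sub>R b)"
  have f': "f' h = D \<bullet> h" for h
  proof -
    have "f' h = f' (\<Sum>b\<in>Basis. (h \<bullet> b) *\<^sub>R b)"
      by (simp add: euclidean_representation)
    also have "\<dots> = (\<Sum>b\<in>Basis. (h \<bullet> b) * f' b)"
      using has_derivative_linear[OF assms] by (simp add: linear_sum linear_scale)
    finally show ?thesis
      by (simp add: D_def inner_sum_left inner_commute[of h] mult.commute)
  qed
  have "GDERIV f x :> D"
    unfolding gderiv_def by (rule has_derivative_eq_rhs[OF assms]) (simp add: f' inner_commute fun_eq_iff)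
  moreover have "E = D" if "GDERIV f x :> E" for E
    using has_derivative_unique[OF that[unfolded gderiv_def] assms] f'
    by (metis inner_commute vector_eq_rdot)
  ultimately have "gradient f x = D"
    unfolding gradient_def by blast
  then show ?thesis
    by (simp add: f')
qed

lemma jacobian_eq_matrix: "(f has_derivative f') (at x) \<Longrightarrow> jacobian f (at x) = matrix f'"
  by (simp add: jacobian_def flip: frechet_derivative_at)

lemma transpose_jacobian_inner:
  fixes f :: "real^'a \<Rightarrow> real^'b"
  assumes "(f has_derivative f') (at x)"
  shows "(transpose (jacobian f (at x)) *v l) \<bullet> h = l \<bullet> f' h"
  using has_derivative_linear[OF assms]
  by (simp add: jacobian_eq_matrix[OF assms] dot_lmul_matrix matrix_works)

text \<open>The Hilbert space adjoint of \<open>B\<close> applied to \<open>l\<close>. As a finite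
  sum over the basis it inherits continuity and polynomial growth termwise, which a transposed
  Jacobian matrix does not show directly.\<close>

definition adjoint_apply :: "('a::euclidean_space \<Rightarrow>\<^sub>L 'b::real_inner) \<Rightarrow> 'b \<Rightarrow> 'a" where
  "adjoint_apply B l = (\<Sum>b\<in>Basis. (l \<bullet> B b) *\<^sub>R b)"

lemma adjoint_apply_inner: "adjoint_apply B l \<bullet> h = l \<bullet> B h"
proof -
  have "B h = (\<Sum>b\<in>Basis. (h \<bullet> b) *\<^sub>R B b)"
    by (subst euclidean_representation[of h, symmetric]) (simp only: blinfun.sum_right blinfun.scaleR_right)
  then show ?thesis
    by (simp add: adjoint_apply_def inner_sum_left inner_sum_right inner_commute[of _ h] mult.commute)
qed

lemma transpose_jacobian_eq_adjoint_apply: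
  fixes f :: "real^'a \<Rightarrow> real^'b"
  assumes "(f has_derivative blinfun_apply f') (at x)"
  shows "transpose (jacobian f (at x)) *v l = adjoint_apply f' l"
  using transpose_jacobian_inner[OF assms] by (metis adjoint_apply_inner vector_eq_rdot)

lemma poly_growth_adjoint_apply:
  "poly_growth f \<Longrightarrow> poly_growth g \<Longrightarrow> poly_growth (\<lambda>z. adjoint_apply (f z) (g z))"
  unfolding adjoint_apply_def by (intro poly_growth_sum poly_growth_intros)

lemma continuous_on_adjoint_apply:
  "continuous_on S f \<Longrightarrow> continuous_on S g \<Longrightarrow> continuous_on S (\<lambda>z. adjoint_apply (f z) (g z))"
  unfolding adjoint_apply_def by (intro continuous_intros)

lemma divergence_eq:
  assumes "(F has_derivative F') (at x)"
  shows "divergence F x = (\<Sum>i\<in>UNIV. F' (axis i 1) $ i)"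
  by (simp add: divergence_def jacobian_eq_matrix[OF assms] trace_def matrix_def)

lemma linear_sum_axis: 
  fixes f' :: "real^'n \<Rightarrow> real"
  assumes "linear f'"
  shows "(\<Sum>i\<in>UNIV. f' (axis i 1) * v $ i) = f' v"
proof -
  have "f' v = f' (\<Sum>i\<in>UNIV. (v $ i) *\<^sub>R axis i 1)"
    using basis_expansion[of v] by (simp add: scalar_mult_eq_scaleR)
  also have "\<dots> = (\<Sum>i\<in>UNIV. f' (axis i 1) * v $ i)"
    using assms by (simp add: linear_sum linear_scale mult.commute)
  finally show ?thesis ..
qed

lemma divergence_scaleR:
  assumes f: "(f has_derivative f') (at x)" and F: "(F has_derivative F') (at x)"
  shows "divergence (\<lambda>y. f y *\<^sub>R F y) x = f' (F x) + f x * divergence F x"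
proof -
  have "((\<lambda>y. f y *\<^sub>R F y) has_derivative (\<lambda>h. f x *\<^sub>R F' h + f' h *\<^sub>R F x)) (at x)"
    by (rule has_derivative_scaleR[OF f F])
  then show ?thesis
    by (simp add: divergence_eq[OF F] divergence_eq sum.distrib sum_distrib_left add.commute
        linear_sum_axis[OF has_derivative_linear[OF f]])
qed

text \<open>Each summand of the divergence is a derivative along a coordinate axis of a rapidly decaying
  function, whose integral vanishes.\<close>

lemma integral_divergence_by_parts:
  fixes f w :: "real^'n \<Rightarrow> real" and F :: "real^'n \<Rightarrow> real^'n"
    and f' w' :: "real^'n \<Rightarrow> (real^'n) \<Rightarrow>\<^sub>L real" and F' :: "real^'n \<Rightarrow> (real^'n) \<Rightarrow>\<^sub>L (real^'n)"
  assumes f: "\<And>x. (f has_derivative f' x) (at x)" "continuous_on UNIV f'"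
      "rapid_decay f" "rapid_decay f'"
    and F: "\<And>x. (F has_derivative F' x) (at x)" "continuous_on UNIV F'"
      "poly_growth F" "poly_growth F'"
    and w: "\<And>x. (w has_derivative w' x) (at x)" "continuous_on UNIV w'"
      "poly_growth w" "poly_growth w'"
  shows "integrable lborel (\<lambda>x. w x * divergence (\<lambda>y. f y *\<^sub>R F y) x)"
    and "(LINT x|lborel. w x * divergence (\<lambda>y. f y *\<^sub>R F y) x) = - (LINT x|lborel. f x * w' x (F x))"
proof -
  have cont: "continuous_on UNIV f" "continuous_on UNIV F" "continuous_on UNIV w"
    using f(1) F(1) w(1) by (meson has_derivative_continuous continuous_at_imp_continuous_on)+
  \<comment> \<open>\<open>\<phi>' i x h\<close> is the derivative of
    \<open>f w (F \<bullet> i)\<close> at \<open>x\<close> in direction \<open>h\<close>. With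
    \<open>i\<close> and \<open>h\<close> both the same coordinate axis, the sum over the axes is
    the divergence of \<open>w f F\<close>.\<close>
  define \<phi>' where "\<phi>' i x h = f' x h *\<^sub>R (w x * (F x \<bullet> i)) + f x *\<^sub>R (w' x h * (F x \<bullet> i) + w x * (F' x h \<bullet> i))"
    for i x h
  have f'h: "rapid_decay (\<lambda>x. f' x h)" for h
    by (rule rapid_decay_le_mult[OF f(4) poly_growth_const[of h]]) (rule norm_blinfun)
  have \<phi>': "rapid_decay (\<lambda>x. \<phi>' i x h)" "continuous_on UNIV (\<lambda>x. \<phi>' i x h)" for i h
    unfolding \<phi>'_def
    by (intro rapid_decay_add rapid_decay_scaleR f'h f poly_growth_intros F w)
       (intro continuous_intros cont f F w)
  have zero: "(LINT x|lborel. \<phi>' i x h) = 0" for i h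
  proof (rule integral_directional_derivative_eq_0)
    show "((\<lambda>x. f x *\<^sub>R (w x * (F x \<bullet> i))) has_derivative \<phi>' i x) (at x)" for x
      unfolding \<phi>'_def
      by (rule derivative_eq_intros f(1) F(1) w(1) refl)+ (simp add: algebra_simps)
    show "rapid_decay (\<lambda>x. f x *\<^sub>R (w x * (F x \<bullet> i)))"
      by (intro rapid_decay_scaleR f poly_growth_intros F w)
  qed (use \<phi>' in auto)
  have sum: "(\<Sum>i\<in>UNIV. \<phi>' (axis i 1) x (axis i 1))
      = w x * divergence (\<lambda>y. f y *\<^sub>R F y) x + f x * w' x (F x)" for x
  proof -
    have "(\<Sum>i\<in>UNIV. \<phi>' (axis i 1) x (axis i 1))
        = (\<Sum>i\<in>UNIV. w x * (f' x (axis i 1) * F x $ i) + f x * (w' x (axis i 1) * F x $ i)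
            + w x * (f x * (F' x (axis i 1) $ i)))"
      by (intro sum.cong) (simp_all add: \<phi>'_def inner_axis algebra_simps)
    then show ?thesis
      by (simp add: sum.distrib divergence_scaleR[OF f(1) F(1)] divergence_eq[OF F(1)] linear_sum_axis
          bounded_linear.linear[OF blinfun.bounded_linear_right] distrib_left flip: sum_distrib_left)
  qed
  have int: "integrable lborel (\<lambda>x. \<phi>' i x h)" for i h
    by (intro integrable_rapid_decay \<phi>' borel_measurable_continuous_onI)
  have int_sum: "integrable lborel (\<lambda>x. w x * divergence (\<lambda>y. f y *\<^sub>R F y) x + f x * w' x (F x))"
    using int by (simp flip: sum)
  have int_w': "integrable lborel (\<lambda>x. f x *\<^sub>R w' x (F x))"
    by (intro integrable_rapid_decay_scaleR cont f poly_growth_intros F w continuous_intros)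
  \<comment> \<open>The divergence term inherits integrability as the difference of the full sum and
    the term with \<open>w'\<close>.\<close>
  show int_div: "integrable lborel (\<lambda>x. w x * divergence (\<lambda>y. f y *\<^sub>R F y) x)"
    using Bochner_Integration.integrable_diff[OF int_sum int_w'] by simp
  have "(LINT x|lborel. w x * divergence (\<lambda>y. f y *\<^sub>R F y) x) + (LINT x|lborel. f x *\<^sub>R w' x (F x))
      = (LINT x|lborel. (\<Sum>i\<in>UNIV. \<phi>' (axis i 1) x (axis i 1)))"
    unfolding sum Bochner_Integration.integral_add[OF int_div int_w', symmetric] by simp
  also have "\<dots> = 0"
    using int zero by simp
  finally show "(LINT x|lborel. w x * divergence (\<lambda>y. f y *\<^sub>R F y) x) = - (LINT x|lborel. f x * w' x (F x))"
    by simp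
qed

section \<open>Symmetry of second derivatives up to the boundary of the domain\<close>

lemma second_difference_mean_value:
  fixes f :: "'a::real_normed_vector \<Rightarrow> real"
  assumes f: "C1_with S f f'" "C1_with S f' f''"
    and S: "\<And>\<sigma> \<tau>. \<sigma> \<in> {0..1} \<Longrightarrow> \<tau> \<in> {0..1} \<Longrightarrow> p + \<sigma> *\<^sub>R a + \<tau> *\<^sub>R b \<in> S"
    and s: "0 < s" "s \<le> 1"
  obtains \<sigma> \<tau> where "\<sigma> \<in> {0..s}" "\<tau> \<in> {0..s}"
    "f (p + s *\<^sub>R a + s *\<^sub>R b) - f (p + s *\<^sub>R a) - (f (p + s *\<^sub>R b) - f p)
      = s\<^sup>2 * f'' (p + \<sigma> *\<^sub>R a + \<tau> *\<^sub>R b) b a"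
proof -
  have der: "(f has_derivative f' y) (at y within S)" "(f' has_derivative f'' y) (at y within S)" if "y \<in> S" for y
    using f that unfolding C1_with_def by auto
  have along_a: "((\<lambda>r. f (p + r *\<^sub>R a + \<tau> *\<^sub>R b)) has_derivative (\<lambda>h. f' (p + r *\<^sub>R a + \<tau> *\<^sub>R b) (h *\<^sub>R a)))
      (at r within {0..s})" if "r \<in> {0..s}" "\<tau> \<in> {0..1}" for r \<tau>
    by (rule has_derivative_in_compose2[OF der(1)])
       (use that s S in \<open>auto intro!: derivative_eq_intros\<close>)
  have along_b: "((\<lambda>r. f' (p + \<sigma> *\<^sub>R a + r *\<^sub>R b) a) has_derivative (\<lambda>h. f'' (p + \<sigma> *\<^sub>R a + r *\<^sub>R b) (h *\<^sub>R b) a))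
      (at r within {0..s})" if "r \<in> {0..s}" "\<sigma> \<in> {0..1}" for r \<sigma>
  proof -
    have "((\<lambda>r. f' (p + \<sigma> *\<^sub>R a + r *\<^sub>R b)) has_derivative (\<lambda>h. f'' (p + \<sigma> *\<^sub>R a + r *\<^sub>R b) (h *\<^sub>R b)))
      (at r within {0..s})"
      by (rule has_derivative_in_compose2[OF der(2)])
         (use that s S in \<open>auto intro!: derivative_eq_intros\<close>)
    from bounded_linear.has_derivative[OF blinfun.bounded_linear_left this] show ?thesis .
  qed
  \<comment> \<open>\<open>g\<close> is the difference between the sides of the parallelogram at
    heights \<open>s\<close> and 0 in direction \<open>b\<close>. The mean value theorem along
    \<open>a\<close> turns its increment into a difference of first derivatives, and a second use
    along \<open>b\<close> produces \<open>f''\<close>.\<close>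
  define g where "g r = f (p + r *\<^sub>R a + s *\<^sub>R b) - f (p + r *\<^sub>R a + 0 *\<^sub>R b)" for r
  have "\<exists>\<sigma>\<in>{0..s}. g s - g 0 = f' (p + \<sigma> *\<^sub>R a + s *\<^sub>R b) ((s - 0) *\<^sub>R a) - f' (p + \<sigma> *\<^sub>R a + 0 *\<^sub>R b) ((s - 0) *\<^sub>R a)"
    unfolding g_def
    by (rule mvt_very_simple) (use s in \<open>auto intro!: has_derivative_diff along_a simp del: scale_zero_left\<close>)
  then obtain \<sigma> where \<sigma>: "\<sigma> \<in> {0..s}"
    "g s - g 0 = s * (f' (p + \<sigma> *\<^sub>R a + s *\<^sub>R b) a - f' (p + \<sigma> *\<^sub>R a + 0 *\<^sub>R b) a)"
    by (auto simp: blinfun.scaleR_right right_diff_distrib)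
  have "\<exists>\<tau>\<in>{0..s}. f' (p + \<sigma> *\<^sub>R a + s *\<^sub>R b) a - f' (p + \<sigma> *\<^sub>R a + 0 *\<^sub>R b) a
      = f'' (p + \<sigma> *\<^sub>R a + \<tau> *\<^sub>R b) ((s - 0) *\<^sub>R b) a"
    by (rule mvt_very_simple) (use s \<sigma> in \<open>auto intro!: along_b simp del: scale_zero_left\<close>)
  then obtain \<tau> where "\<tau> \<in> {0..s}" "f' (p + \<sigma> *\<^sub>R a + s *\<^sub>R b) a - f' (p + \<sigma> *\<^sub>R a + 0 *\<^sub>R b) a
      = s * f'' (p + \<sigma> *\<^sub>R a + \<tau> *\<^sub>R b) b a"
    by (auto simp: blinfun.scaleR_right blinfun.scaleR_left)
  with \<sigma> that[of \<sigma> \<tau>] show ?thesis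
    by (simp add: g_def power2_eq_square mult.assoc)
qed

text \<open>The second difference over the parallelogram spanned by \<open>s a\<close> and
  \<open>s b\<close> does not change when \<open>a\<close> and \<open>b\<close> are exchanged.
  Dividing by the square of \<open>s\<close> and letting \<open>s\<close> tend to 0 leaves the two
  mixed derivatives, by continuity of \<open>f''\<close>. Only one parallelogram with corner
  \<open>p\<close> has to lie in \<open>S\<close>, so \<open>p\<close> may be a boundary
  point.\<close>

lemma second_derivative_symmetric:
  fixes f :: "'a::real_normed_vector \<Rightarrow> real"
  assumes f: "C1_with S f f'" "C1_with S f' f''"
    and S: "\<And>\<sigma> \<tau>. \<sigma> \<in> {0..1} \<Longrightarrow> \<tau> \<in> {0..1} \<Longrightarrow> p + \<sigma> *\<^sub>R a + \<tau> *\<^sub>R b \<in> S"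
  shows "f'' p a b = f'' p b a"
proof -
  define s where "s n = inverse (real (Suc n))" for n
  have s: "0 < s n" "s n \<le> 1" for n
    by (auto simp: s_def divide_simps)
  have "s \<longlonglongrightarrow> 0"
    unfolding s_def by (rule LIMSEQ_inverse_real_of_nat)
  have lim: "(\<lambda>n. f'' (p + \<sigma> n *\<^sub>R a + \<tau> n *\<^sub>R b) c d) \<longlonglongrightarrow> f'' p c d"
    if "\<And>n. \<sigma> n \<in> {0..s n}" "\<And>n. \<tau> n \<in> {0..s n}" for \<sigma> \<tau> c d
  proof -
    have "\<sigma> \<longlonglongrightarrow> 0" "\<tau> \<longlonglongrightarrow> 0"
      using that by (auto intro!: tendsto_sandwich[OF _ _ tendsto_const \<open>s \<longlonglongrightarrow> 0\<close>] always_eventually)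
    then have "(\<lambda>n. p + \<sigma> n *\<^sub>R a + \<tau> n *\<^sub>R b) \<longlonglongrightarrow> p + 0 *\<^sub>R a + 0 *\<^sub>R b"
      by (intro tendsto_intros)
    moreover have "p + \<sigma> n *\<^sub>R a + \<tau> n *\<^sub>R b \<in> S" for n
      using that[of n] s[of n] by (intro S) auto
    moreover have "p \<in> S"
      using S[of 0 0] by simp
    moreover have "continuous_on S f''"
      using f(2) by (simp add: C1_with_def)
    ultimately have "(\<lambda>n. f'' (p + \<sigma> n *\<^sub>R a + \<tau> n *\<^sub>R b)) \<longlonglongrightarrow> f'' p"
      by (intro continuous_on_tendsto_compose[of S f'']) auto
    then show ?thesis
      by (intro tendsto_intros)
  qed
  have "\<exists>\<sigma> \<tau>. \<sigma> \<in> {0..s n} \<and> \<tau> \<in> {0..s n} \<and>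
      f (p + s n *\<^sub>R a + s n *\<^sub>R b) - f (p + s n *\<^sub>R a) - (f (p + s n *\<^sub>R b) - f p)
        = (s n)\<^sup>2 * f'' (p + \<sigma> *\<^sub>R a + \<tau> *\<^sub>R b) b a" for n
    by (rule second_difference_mean_value[OF f S s, of n]) blast+
  then obtain \<sigma> \<tau> where 1: "\<And>n. \<sigma> n \<in> {0..s n}" "\<And>n. \<tau> n \<in> {0..s n}"
      "\<And>n. f (p + s n *\<^sub>R a + s n *\<^sub>R b) - f (p + s n *\<^sub>R a) - (f (p + s n *\<^sub>R b) - f p)
        = (s n)\<^sup>2 * f'' (p + \<sigma> n *\<^sub>R a + \<tau> n *\<^sub>R b) b a"
    by metis
  have S': "p + \<sigma> *\<^sub>R b + \<tau> *\<^sub>R a \<in> S" if "\<sigma> \<in> {0..1}" "\<tau> \<in> {0..1}" for \<sigma> \<tau>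
    using S[OF that(2,1)] by (simp add: ac_simps)
  have "\<exists>\<sigma> \<tau>. \<sigma> \<in> {0..s n} \<and> \<tau> \<in> {0..s n} \<and>
      f (p + s n *\<^sub>R b + s n *\<^sub>R a) - f (p + s n *\<^sub>R b) - (f (p + s n *\<^sub>R a) - f p)
        = (s n)\<^sup>2 * f'' (p + \<sigma> *\<^sub>R b + \<tau> *\<^sub>R a) a b" for n
    by (rule second_difference_mean_value[OF f S' s, of n]) blast+
  then obtain \<sigma>' \<tau>' where 2: "\<And>n. \<sigma>' n \<in> {0..s n}" "\<And>n. \<tau>' n \<in> {0..s n}"
      "\<And>n. f (p + s n *\<^sub>R b + s n *\<^sub>R a) - f (p + s n *\<^sub>R b) - (f (p + s n *\<^sub>R a) - f p)
        = (s n)\<^sup>2 * f'' (p + \<sigma>' n *\<^sub>R b + \<tau>' n *\<^sub>R a) a b"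
    by metis
  have "f'' (p + \<sigma> n *\<^sub>R a + \<tau> n *\<^sub>R b) b a = f'' (p + \<tau>' n *\<^sub>R a + \<sigma>' n *\<^sub>R b) a b" for n
  proof -
    have "(s n)\<^sup>2 * f'' (p + \<sigma> n *\<^sub>R a + \<tau> n *\<^sub>R b) b a = (s n)\<^sup>2 * f'' (p + \<sigma>' n *\<^sub>R b + \<tau>' n *\<^sub>R a) a b"
      unfolding 1(3)[symmetric] 2(3)[symmetric] by (simp add: algebra_simps)
    then show ?thesis
      using s(1)[of n] by (simp add: algebra_simps)
  qed
  then show ?thesis
    using lim[OF 1(1,2), of b a] lim[OF 2(2,1), of a b] LIMSEQ_unique by simp blast
qed

section \<open>Differentiation on the time-space slab, one-sided at the end points\<close>

lemma has_derivative_unique_time_space: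
  fixes f :: "real \<times> 'a::euclidean_space \<Rightarrow> 'b::real_normed_vector"
  assumes "T > 0" "t \<in> {0..T}"
    and "(f has_derivative f') (at (t, x) within {0..T} \<times> UNIV)"
    and "(f has_derivative f'') (at (t, x) within {0..T} \<times> UNIV)"
  shows "f' = f''"
proof (rule frechet_derivative_unique_within[OF assms(3,4)])
  fix i :: "real \<times> 'a" and e :: real
  assume i: "i \<in> Basis" and e: "0 < e"
  \<comment> \<open>Uniqueness on a set that is not open requires arbitrarily small nonzero steps
    inside it along each basis vector. A time step of at most \<open>T / 2\<close> stays in the
    interval if it points away from the nearer end; a spatial step is unrestricted.\<close>
  define d where "d = min (e / 2) (T / 2)"
  have d: "0 < d" "d < e" "d \<le> T / 2"
    using e assms(1) by (auto simp: d_def)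
  consider "i = (1, 0)" | b where "i = (0, b)"
    using i by (auto simp: Basis_prod_def)
  then show "\<exists>d. 0 < \<bar>d\<bar> \<and> \<bar>d\<bar> < e \<and> (t, x) + d *\<^sub>R i \<in> {0..T} \<times> UNIV"
  proof cases
    case 1
    then show ?thesis
      using d assms(1,2) by (intro exI[of _ "if t \<le> T / 2 then d else - d"]) (auto simp: field_simps)
  next
    case 2
    then show ?thesis
      using d assms(2) by (intro exI[of _ d]) auto
  qed
qed

lemma has_derivative_slice:
  assumes "(f has_derivative f') (at (t, x) within I \<times> UNIV)" "t \<in> I"
  shows "((\<lambda>y. f (t, y)) has_derivative (\<lambda>h. f' (0, h))) (at x)"
    and "((\<lambda>s. f (s, x)) has_derivative (\<lambda>r. f' (r, 0))) (at t within I)"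
proof -
  have "((\<lambda>y. f (t, y)) has_derivative (\<lambda>h. f' (0, h))) (at x within UNIV)"
    by (rule has_derivative_in_compose[where g = f and f = "\<lambda>y. (t, y)"])
       (use assms in \<open>auto intro!: derivative_eq_intros elim!: has_derivative_subset\<close>)
  then show "((\<lambda>y. f (t, y)) has_derivative (\<lambda>h. f' (0, h))) (at x)"
    by simp
  show "((\<lambda>s. f (s, x)) has_derivative (\<lambda>r. f' (r, 0))) (at t within I)"
    by (rule has_derivative_in_compose[where g = f and f = "\<lambda>s. (s, x)"])
       (use assms in \<open>auto intro!: derivative_eq_intros elim!: has_derivative_subset\<close>)
qed

lemma dt_eq:
  assumes "T > 0" "t \<in> {0..T}" "(g has_derivative g') (at t within {0..T})"
  shows "dt T g t = g' 1"
  unfolding dt_def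
proof (rule vector_derivative_within_closed_interval[OF assms(1,2)])
  have "g' r = r *\<^sub>R g' 1" for r
    using linear_scale[OF has_derivative_linear[OF assms(3)], of r 1] by simp
  then show "(g has_vector_derivative g' 1) (at t within {0..T})"
    unfolding has_vector_derivative_def using assms(3) by (metis (no_types, lifting) has_derivative_eq_rhs ext)
qed

lemma rapid_decay_slice: "rapid_decay g \<Longrightarrow> rapid_decay (\<lambda>y. g (x, y))"
  unfolding rapid_decay_def
proof
  fix k assume "\<forall>k. \<exists>C. \<forall>z. (1 + norm z) ^ k * norm (g z) \<le> C"
  then obtain C where C: "\<And>z. (1 + norm z) ^ k * norm (g z) \<le> C"
    by blast
  have "(1 + norm y) ^ k * norm (g (x, y)) \<le> (1 + norm (x, y)) ^ k * norm (g (x, y))" for y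
    by (intro mult_right_mono power_mono) (auto simp: norm_prod_def)
  then show "\<exists>C. \<forall>y. (1 + norm y) ^ k * norm (g (x, y)) \<le> C"
    using C order_trans by blast
qed

lemma C1_with_imp_continuous_on:
  assumes "C1_with S f f'"
  shows "continuous_on S f" "continuous_on S f'"
  using assms unfolding C1_with_def
  by (auto simp: continuous_on_eq_continuous_within intro: has_derivative_continuous)

lemma has_derivative_imp_continuous_on:
  "(\<And>x. (f has_derivative f' x) (at x)) \<Longrightarrow> continuous_on S f"
  by (meson has_derivative_continuous continuous_at_imp_continuous_on)

text \<open>The decay of \<open>f\<close> and \<open>f'\<close> in the pair of state and multiplier
  bounds both, after multiplication by \<open>w\<close>, by a constant times a weight in
  \<open>l\<close> alone, uniformly in time and state. This is the source of all differentiability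
  in time and space of \<open>fMO\<close> and of the first moment.\<close>

lemma has_derivative_moment:
  fixes f :: "real \<times> 'x::euclidean_space \<times> 'l::euclidean_space \<Rightarrow> real"
  assumes f: "C1_with ({0..T} \<times> UNIV) f f'"
    and decay: "\<And>k. \<exists>C. \<forall>t\<in>{0..T}. \<forall>z. (1 + norm z) ^ k * (\<bar>f (t, z)\<bar> + norm (f' (t, z))) \<le> C"
    and w: "continuous_on UNIV w" "poly_growth w"
    and t: "t \<in> {0..T}"
  shows "((\<lambda>p. LINT l|lborel. f (fst p, snd p, l) * w l) has_derivative
      (\<lambda>h. LINT l|lborel. f' (t, x, l) (fst h, snd h, 0) * w l)) (at (t, x) within {0..T} \<times> UNIV)"
proof -
  \<comment> \<open>A displacement in time and state with zero multiplier component. Composing with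
    it keeps the derivative a bounded linear map, at the price of the factor
    \<open>norm \<iota>\<close> in the majorant.\<close>
  define \<iota> where "\<iota> = Blinfun (\<lambda>h::real \<times> 'x. (fst h, snd h, 0::'l))"
  have \<iota>: "\<iota> h = (fst h, snd h, 0)" for h
    unfolding \<iota>_def by (subst bounded_linear_Blinfun_apply) (auto intro!: bounded_linear_intros)
  obtain D m where D: "D \<ge> 0" "\<And>l. norm (w l) \<le> D * (1 + norm l) ^ m"
    using poly_growthE[OF w(2)] by blast
  \<comment> \<open>The first \<open>m\<close> powers pay for the growth of \<open>w\<close>, the
    other \<open>2 * DIM('l)\<close> become the integrable weight.\<close>
  obtain C where C: "\<And>t z. t \<in> {0..T} \<Longrightarrow>
      (1 + norm z) ^ (m + 2 * DIM('l)) * (\<bar>f (t, z)\<bar> + norm (f' (t, z))) \<le> C"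
    using decay by blast
  have bound: "(\<bar>f (s, y, l)\<bar> + norm (f' (s, y, l))) * norm (w l) \<le> D * C * decay_weight l"
    if "s \<in> {0..T}" for s y l
  proof -
    have "(1 + norm l) ^ (m + 2 * DIM('l)) * (\<bar>f (s, y, l)\<bar> + norm (f' (s, y, l)))
        \<le> (1 + norm (y, l)) ^ (m + 2 * DIM('l)) * (\<bar>f (s, y, l)\<bar> + norm (f' (s, y, l)))"
      by (intro mult_right_mono power_mono) (auto simp: norm_prod_def)
    also have "\<dots> \<le> C"
      by (rule C[OF that])
    finally have "(1 + norm l) ^ m * (\<bar>f (s, y, l)\<bar> + norm (f' (s, y, l))) \<le> C * decay_weight l"
      by (rule decay_weight_bound)
    then have "D * ((1 + norm l) ^ m * (\<bar>f (s, y, l)\<bar> + norm (f' (s, y, l)))) \<le> D * (C * decay_weight l)"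
      using D by (intro mult_left_mono)
    moreover have "(\<bar>f (s, y, l)\<bar> + norm (f' (s, y, l))) * norm (w l)
        \<le> (\<bar>f (s, y, l)\<bar> + norm (f' (s, y, l))) * (D * (1 + norm l) ^ m)"
      using D by (intro mult_left_mono) auto
    ultimately show ?thesis
      by (simp add: ac_simps)
  qed
  have bounds: "\<bar>f (s, y, l)\<bar> * norm (w l) \<le> D * C * decay_weight l"
      "norm (f' (s, y, l)) * norm (w l) \<le> D * C * decay_weight l"
    if "s \<in> {0..T}" for s y l
  proof -
    have "\<bar>f (s, y, l)\<bar> * norm (w l) \<le> (\<bar>f (s, y, l)\<bar> + norm (f' (s, y, l))) * norm (w l)"
      "norm (f' (s, y, l)) * norm (w l) \<le> (\<bar>f (s, y, l)\<bar> + norm (f' (s, y, l))) * norm (w l)"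
      by (intro mult_right_mono; simp)+
    with bound[OF that, of y l] show "\<bar>f (s, y, l)\<bar> * norm (w l) \<le> D * C * decay_weight l"
      "norm (f' (s, y, l)) * norm (w l) \<le> D * C * decay_weight l"
      by linarith+
  qed
  have cont: "continuous_on UNIV (\<lambda>l. f (s, y, l))" "continuous_on UNIV (\<lambda>l. f' (s, y, l))"
    if "s \<in> {0..T}" for s y
  proof -
    show "continuous_on UNIV (\<lambda>l. f (s, y, l))" "continuous_on UNIV (\<lambda>l. f' (s, y, l))"
      using that by (auto intro!: continuous_intros continuous_on_compose2[OF C1_with_imp_continuous_on(1)[OF f]]
          continuous_on_compose2[OF C1_with_imp_continuous_on(2)[OF f]])
  qed
  have "((\<lambda>p. LINT l|lborel. f (fst p, snd p, l) * w l) has_derivative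
      (\<lambda>h. LINT l|lborel. (w l *\<^sub>R (f' (fst (t, x), snd (t, x), l) o\<^sub>L \<iota>)) h)) (at (t, x) within {0..T} \<times> UNIV)"
  proof (rule has_derivative_integral_dominated)
    show "((\<lambda>p. f (fst p, snd p, l) * w l) has_derivative (w l *\<^sub>R (f' (fst p, snd p, l) o\<^sub>L \<iota>)))
        (at p within {0..T} \<times> UNIV)" if "p \<in> {0..T} \<times> UNIV" for p l
    proof -
      have "((\<lambda>p. f (fst p, snd p, l)) has_derivative (\<lambda>h. f' (fst p, snd p, l) (fst h, snd h, 0)))
        (at p within {0..T} \<times> UNIV)"
        by (rule has_derivative_in_compose2[where t = "{0..T} \<times> UNIV" and g' = "\<lambda>y. blinfun_apply (f' y)"])
           (use f that in \<open>auto simp: C1_with_def intro!: derivative_eq_intros\<close>)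
      from has_derivative_mult_left[OF this, of "w l"] show ?thesis
        by (simp add: scaleR_blinfun.rep_eq \<iota> mult.commute)
    qed
    show "integrable lborel (\<lambda>l. f (fst p, snd p, l) * w l)" if "p \<in> {0..T} \<times> UNIV" for p
    proof (rule Bochner_Integration.integrable_bound)
      show "integrable lborel (\<lambda>l. D * C * decay_weight l :: real)"
        by (intro integrable_mult_right integrable_decay_weight)
      show "(\<lambda>l. f (fst p, snd p, l) * w l) \<in> borel_measurable lborel"
        using that by (auto intro!: borel_measurable_continuous_onI continuous_intros cont w)
      show "AE l in lborel. norm (f (fst p, snd p, l) * w l) \<le> norm (D * C * decay_weight l)"
      proof (rule AE_I2)
        fix l
        have "fst p \<in> {0..T}"
          using that by auto
        have "norm (f (fst p, snd p, l) * w l) \<le> D * C * decay_weight l"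
          using bounds(1)[OF \<open>fst p \<in> {0..T}\<close>, of "snd p" l] by (simp add: abs_mult)
        then show "norm (f (fst p, snd p, l) * w l) \<le> norm (D * C * decay_weight l)"
          unfolding real_norm_def by (rule order_trans[OF _ abs_ge_self])
      qed
    qed
    show "(\<lambda>l. (w l *\<^sub>R (f' (fst (t, x), snd (t, x), l) o\<^sub>L \<iota>)) h) \<in> borel_measurable lborel" for h
      using t by (simp add: scaleR_blinfun.rep_eq, intro borel_measurable_continuous_onI continuous_on_mult
          w(1) blinfun.continuous_on continuous_on_const cont(2)) auto
    show "integrable lborel (\<lambda>l. norm \<iota> * (D * C * decay_weight l))"
      by (intro integrable_mult_right integrable_decay_weight)
    show "norm (w l *\<^sub>R (f' (fst p, snd p, l) o\<^sub>L \<iota>)) \<le> norm \<iota> * (D * C * decay_weight l)"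
      if "p \<in> {0..T} \<times> UNIV" for p l
    proof -
      have "fst p \<in> {0..T}"
        using that by auto
      have "norm (w l *\<^sub>R (f' (fst p, snd p, l) o\<^sub>L \<iota>)) \<le> \<bar>w l\<bar> * (norm (f' (fst p, snd p, l)) * norm \<iota>)"
        by (simp add: norm_blinfun_compose mult_left_mono)
      also have "\<dots> = norm \<iota> * (norm (f' (fst p, snd p, l)) * \<bar>w l\<bar>)"
        by simp
      also have "\<dots> \<le> norm \<iota> * (D * C * decay_weight l)"
        using bounds(2)[OF \<open>fst p \<in> {0..T}\<close>, of "snd p" l] by (intro mult_left_mono) auto
      finally show ?thesis .
    qed
  qed (use t in \<open>auto intro!: convex_Times\<close>)
  then show ?thesis
    by (simp add: scaleR_blinfun.rep_eq \<iota> mult.commute)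
qed

text \<open>The zero set of the continuous function \<open>g\<close> is closed and contains every
  point where \<open>f\<close> does not vanish, hence also their closure.\<close>

lemma eq_0_on_support:
  fixes f :: "'a::metric_space \<Rightarrow> real" and g :: "'a \<Rightarrow> real"
  assumes "continuous_on UNIV g" "\<And>x. f x * g x = 0" "x \<in> closure {x. f x \<noteq> 0}"
  shows "g x = 0"
proof -
  have "closed {x. g x = 0}"
    using continuous_closed_preimage_constant[OF assms(1) closed_UNIV, of 0] by simp
  then have "closure {x. f x \<noteq> 0} \<subseteq> {x. g x = 0}"
    using assms(2) by (intro closure_minimal) auto
  then show ?thesis
    using assms(3) by blast
qed

lemma poly_growth_blinfun_inner_right:
  fixes f :: "_ \<Rightarrow> 'b::real_inner"
  assumes "poly_growth f"
  shows "poly_growth (\<lambda>z. blinfun_inner_right (f z))"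
  using assms
proof (rule poly_growth_le)
  show "norm (blinfun_inner_right (f z)) \<le> norm (f z)" for z
    by (rule norm_blinfun_bound) (auto simp: Cauchy_Schwarz_ineq2)
qed

section \<open>The two optimality systems\<close>

text \<open>The derivatives whose existence the regularity hypotheses assert are fixed here as
  functions, so that both systems can be expanded in the same terms.\<close>

locale mean_field =
  fixes T \<alpha> :: real
    and G :: "real^'n \<Rightarrow> real^'n \<Rightarrow> real^'m \<Rightarrow> real^'n"
    and J :: "real^'m \<Rightarrow> real^'n \<Rightarrow> real"
    and mt :: "real^'n \<Rightarrow> real^'n"
    and u :: "real \<Rightarrow> real^'n \<Rightarrow> real^'m"
    and fOM f2 :: "real \<Rightarrow> real^'n \<Rightarrow> real^'n \<Rightarrow> real"
    and fMO \<Lambda> :: "real \<Rightarrow> real^'n \<Rightarrow> real"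
    and G' :: "(real^'n) \<times> (real^'n) \<times> (real^'m) \<Rightarrow> ((real^'n) \<times> (real^'n) \<times> (real^'m)) \<Rightarrow>\<^sub>L (real^'n)"
    and J' :: "(real^'m) \<times> (real^'n) \<Rightarrow> ((real^'m) \<times> (real^'n)) \<Rightarrow>\<^sub>L real"
    and mt' :: "real^'n \<Rightarrow> (real^'n) \<Rightarrow>\<^sub>L (real^'n)"
    and u' :: "real \<Rightarrow> real^'n \<Rightarrow> (real^'n) \<Rightarrow>\<^sub>L (real^'m)"
    and f' :: "real \<times> (real^'n) \<times> (real^'n) \<Rightarrow> (real \<times> (real^'n) \<times> (real^'n)) \<Rightarrow>\<^sub>L real"
    and \<Lambda>' :: "real \<times> (real^'n) \<Rightarrow> (real \<times> (real^'n)) \<Rightarrow>\<^sub>L real"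
    and \<Lambda>'' :: "real \<times> (real^'n) \<Rightarrow> (real \<times> (real^'n)) \<Rightarrow>\<^sub>L ((real \<times> (real^'n)) \<Rightarrow>\<^sub>L real)"
  assumes T: "T > 0"
    and G: "C1_with UNIV (\<lambda>(x, y, v). G x y v) G'" "poly_growth (\<lambda>(x, y, v). G x y v)" "poly_growth G'"
    and J: "C1_with UNIV (\<lambda>(v, p). J v p) J'"
    and mt: "C1_with UNIV mt mt'"
    and u: "\<And>t. t \<in> {0..T} \<Longrightarrow> C1_with UNIV (u t) (u' t)" "\<And>t. t \<in> {0..T} \<Longrightarrow> poly_growth (u t)"
    and f: "C1_with ({0..T} \<times> UNIV) (\<lambda>(t, x, l). fOM t x l) f'"
    and f_decay: "\<And>k. \<exists>C. \<forall>t\<in>{0..T}. \<forall>z.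
        (1 + norm z) ^ k * (\<bar>fOM t (fst z) (snd z)\<bar> + norm (f' (t, z))) \<le> C"
    and \<Lambda>: "C1_with ({0..T} \<times> UNIV) (\<lambda>(t, x). \<Lambda> t x) \<Lambda>'" "C1_with ({0..T} \<times> UNIV) \<Lambda>' \<Lambda>''"
    and f2: "\<And>t x. t \<in> {0..T} \<Longrightarrow> x \<in> density_support fMO t \<Longrightarrow>
        integrable lborel (f2 t x) \<and> (LINT l|lborel. f2 t x l) = 1 \<and> integrable lborel (\<lambda>l. f2 t x l *\<^sub>R l)"
    and factorization: "\<And>t x l. t \<in> {0..T} \<Longrightarrow> fOM t x l = fMO t x * f2 t x l"
    and identification: "\<And>t x. t \<in> {0..T} \<Longrightarrow> x \<in> density_support fMO t \<Longrightarrow>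
        gradient (\<Lambda> t) x = - (LINT l|lborel. f2 t x l *\<^sub>R l)"
begin

section \<open>Partial derivatives of the data in terms of their total derivatives\<close>

abbreviation in1 :: "(real^'n) \<Rightarrow>\<^sub>L ((real^'n) \<times> (real^'n) \<times> (real^'m))" where
  "in1 \<equiv> Blinfun (\<lambda>h. (h, 0, 0))"

abbreviation in2 :: "(real^'n) \<Rightarrow>\<^sub>L ((real^'n) \<times> (real^'n) \<times> (real^'m))" where
  "in2 \<equiv> Blinfun (\<lambda>h. (0, h, 0))"

abbreviation in3 :: "(real^'m) \<Rightarrow>\<^sub>L ((real^'n) \<times> (real^'n) \<times> (real^'m))" where
  "in3 \<equiv> Blinfun (\<lambda>h. (0, 0, h))"

abbreviation in13 :: "((real^'n) \<times> (real^'m)) \<Rightarrow>\<^sub>L ((real^'n) \<times> (real^'n) \<times> (real^'m))" where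
  "in13 \<equiv> Blinfun (\<lambda>h. (fst h, 0, snd h))"

lemma in_apply: "in1 h = (h, 0, 0)" "in2 h = (0, h, 0)" "in3 v = (0, 0, v)" "in13 p = (fst p, 0, snd p)"
  by (subst bounded_linear_Blinfun_apply; auto intro!: bounded_linear_intros)+

lemma has_derivative_G:
  assumes "(a has_derivative a') (at z)" "(b has_derivative b') (at z)" "(c has_derivative c') (at z)"
  shows "((\<lambda>z. G (a z) (b z) (c z)) has_derivative (\<lambda>h. G' (a z, b z, c z) (a' h, b' h, c' h))) (at z)"
proof -
  have "((\<lambda>(x, y, v). G x y v) has_derivative G' (a z, b z, c z)) (at (a z, b z, c z))"
    using G(1) by (simp add: C1_with_def)
  from has_derivative_compose[OF has_derivative_Pair[OF assms(1) has_derivative_Pair[OF assms(2,3)]] this]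
  show ?thesis
    by simp
qed

lemma continuous_on_G:
  assumes "continuous_on S a" "continuous_on S b" "continuous_on S c"
  shows "continuous_on S (\<lambda>z. G (a z) (b z) (c z))"
proof -
  from continuous_on_compose2[OF C1_with_imp_continuous_on(1)[OF G(1)] continuous_on_Pair[OF assms(1) continuous_on_Pair[OF assms(2,3)]]]
  show ?thesis
    by simp
qed

lemma continuous_on_G':
  assumes "continuous_on S a" "continuous_on S b" "continuous_on S c"
  shows "continuous_on S (\<lambda>z. G' (a z, b z, c z))"
  by (rule continuous_on_compose2[OF C1_with_imp_continuous_on(2)[OF G(1)]
        continuous_on_Pair[OF assms(1) continuous_on_Pair[OF assms(2,3)]]]) simp

lemma poly_growth_G:
  assumes "poly_growth a" "poly_growth b" "poly_growth c"
  shows "poly_growth (\<lambda>z. G (a z) (b z) (c z))"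
  using poly_growth_compose[OF G(2) poly_growth_Pair[OF assms(1) poly_growth_Pair[OF assms(2,3)]]] by simp

lemma poly_growth_G':
  assumes "poly_growth a" "poly_growth b" "poly_growth c"
  shows "poly_growth (\<lambda>z. G' (a z, b z, c z))"
  by (rule poly_growth_compose[OF G(3) poly_growth_Pair[OF assms(1) poly_growth_Pair[OF assms(2,3)]]])

lemma transpose_D1: "transpose (D1 G x y v) *v l = adjoint_apply (G' (x, y, v) o\<^sub>L in1) l"
  unfolding D1_def
  by (rule transpose_jacobian_eq_adjoint_apply) (rule has_derivative_eq_rhs[OF has_derivative_G], rule derivative_intros, rule derivative_intros, rule derivative_intros, simp add: in_apply fun_eq_iff)

lemma transpose_D2: "transpose (D2 G x y v) *v l = adjoint_apply (G' (x, y, v) o\<^sub>L in2) l"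
  unfolding D2_def
  by (rule transpose_jacobian_eq_adjoint_apply) (rule has_derivative_eq_rhs[OF has_derivative_G], rule derivative_intros, rule derivative_intros, rule derivative_intros, simp add: in_apply fun_eq_iff)

lemma transpose_Du: "transpose (Du G x y v) *v l = adjoint_apply (G' (x, y, v) o\<^sub>L in3) l"
  unfolding Du_def
  by (rule transpose_jacobian_eq_adjoint_apply) (rule has_derivative_eq_rhs[OF has_derivative_G], rule derivative_intros, rule derivative_intros, rule derivative_intros, simp add: in_apply fun_eq_iff)

lemma has_derivative_J:
  assumes "(a has_derivative a') (at z)" "(b has_derivative b') (at z)"
  shows "((\<lambda>z. J (a z) (b z)) has_derivative (\<lambda>h. J' (a z, b z) (a' h, b' h))) (at z)"
proof -
  have "((\<lambda>(v, p). J v p) has_derivative J' (a z, b z)) (at (a z, b z))"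
    using J by (simp add: C1_with_def)
  from has_derivative_compose[OF has_derivative_Pair[OF assms] this] show ?thesis
    by simp
qed

lemma grad_u_inner: "grad_u J v p \<bullet> h = J' (v, p) (h, 0)"
  unfolding grad_u_def by (rule gradient_inner) (rule has_derivative_eq_rhs[OF has_derivative_J], rule derivative_intros, rule derivative_intros, simp)

lemma grad_m_inner: "grad_m J v p \<bullet> h = J' (v, p) (0, h)"
  unfolding grad_m_def by (rule gradient_inner) (rule has_derivative_eq_rhs[OF has_derivative_J], rule derivative_intros, rule derivative_intros, simp)

lemma has_derivative_mt: "(mt has_derivative mt' x) (at x)"
  using mt by (simp add: C1_with_def)

end

section \<open>The velocity field and the nonlocal reaction term at a fixed time\<close>

locale mean_field_at = mean_field T \<alpha> G J mt u fOM f2 fMO \<Lambda> G' J' mt' u' f' \<Lambda>' \<Lambda>''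
  for T \<alpha> and G :: "real^'n \<Rightarrow> real^'n \<Rightarrow> real^'m \<Rightarrow> real^'n"
    and J mt u fOM f2 fMO \<Lambda> G' J' mt' u' f' \<Lambda>' \<Lambda>'' +
  fixes t :: real
  assumes t: "t \<in> {0..T}"
begin

abbreviation fz :: "(real^'n) \<times> (real^'n) \<Rightarrow> real" where
  "fz z \<equiv> fOM t (fst z) (snd z)"

lemma has_derivative_u: "(u t has_derivative u' t x) (at x)"
  using u(1)[OF t] by (simp add: C1_with_def)

lemma continuous_on_u: "continuous_on S g \<Longrightarrow> continuous_on S (\<lambda>z. u t (g z))"
  by (rule continuous_on_compose2[OF C1_with_imp_continuous_on(1)[OF u(1)[OF t]]]) simp_all

lemma poly_growth_u: "poly_growth g \<Longrightarrow> poly_growth (\<lambda>z. u t (g z))"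
  by (rule poly_growth_compose[OF u(2)[OF t]])

lemma has_derivative_fz: "(fz has_derivative (\<lambda>h. f' (t, z) (0, h))) (at z)"
proof -
  have "((\<lambda>(t, x, l). fOM t x l) has_derivative f' (t, z)) (at (t, z) within {0..T} \<times> UNIV)"
    using f[unfolded C1_with_def, THEN conjunct1, rule_format, of "(t, z)"] t by simp
  from has_derivative_slice(1)[OF this t] show ?thesis
    by (simp add: case_prod_unfold)
qed

lemma continuous_on_fz: "continuous_on S fz"
  by (rule has_derivative_imp_continuous_on[OF has_derivative_fz])

lemma continuous_on_f': "continuous_on S g \<Longrightarrow> continuous_on S (\<lambda>z. f' (t, g z))"
  by (rule continuous_on_compose2[OF C1_with_imp_continuous_on(2)[OF f] continuous_on_Pair[OF continuous_on_const]])
    (use t in auto)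

lemma rapid_decay_fz: "rapid_decay fz" and rapid_decay_f': "rapid_decay (\<lambda>z. f' (t, z))"
proof -
  have "\<exists>C. \<forall>z. (1 + norm z) ^ k * norm (fz z) \<le> C \<and> (1 + norm z) ^ k * norm (f' (t, z)) \<le> C" for k
  proof -
    obtain C where C: "\<And>z. (1 + norm z) ^ k * (\<bar>fz z\<bar> + norm (f' (t, z))) \<le> C"
      using f_decay[of k] t by blast
    have "(1 + norm z) ^ k * norm (fz z) \<le> C \<and> (1 + norm z) ^ k * norm (f' (t, z)) \<le> C" for z
    proof -
      have "0 \<le> (1 + norm z) ^ k * norm (fz z)" "0 \<le> (1 + norm z) ^ k * norm (f' (t, z))"
        by (intro mult_nonneg_nonneg; simp)+
      then show ?thesis
        using C[of z] unfolding distrib_left real_norm_def by linarith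
    qed
    then show ?thesis
      by blast
  qed
  then show "rapid_decay fz" "rapid_decay (\<lambda>z. f' (t, z))"
    unfolding rapid_decay_def by blast+
qed

lemma integrable_fz: "poly_growth \<Psi> \<Longrightarrow> continuous_on UNIV \<Psi> \<Longrightarrow> integrable lborel (\<lambda>z. fz z *\<^sub>R \<Psi> z)"
  for \<Psi> :: "_ \<Rightarrow> 'b::{banach, second_countable_topology}"
  by (rule integrable_rapid_decay_scaleR[OF rapid_decay_fz continuous_on_fz])

abbreviation vel :: "real^'n \<Rightarrow> real^'n" where
  "vel \<equiv> OM_velocity G u fOM t"

text \<open>\<open>vel_x\<close> and \<open>vel_u\<close> separate the two ways in which the
  velocity depends on the state: directly, and through the feedback control. The direct part occurs
  in the force on the multiplier, while the part through the control has to recombine into the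
  control equation.\<close>

definition vel_x :: "real^'n \<Rightarrow> real^'n \<Rightarrow> real^'n" where
  "vel_x x h = (LINT z|lborel. fz z *\<^sub>R G' (x, fst z, u t x) (h, 0, 0))"

definition vel_u :: "real^'n \<Rightarrow> real^'m \<Rightarrow> real^'n" where
  "vel_u x h = (LINT z|lborel. fz z *\<^sub>R G' (x, fst z, u t x) (0, 0, h))"

text \<open>Up to sign, \<open>react\<close> is the nonlocal term of the adjoint equation that involves \<open>\<nabla>\<Lambda>\<close> at the
  hatted state, with \<open>f\<^sup>M\<^sup>O \<nabla>\<Lambda>\<close> replaced by the first moment of \<open>f\<^sup>O\<^sup>M\<close>.\<close>

definition react :: "real^'n \<Rightarrow> real" where
  "react x = (LINT z|lborel. fz z *\<^sub>R (snd z \<bullet> G (fst z) x (u t (fst z))))"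

definition react' :: "real^'n \<Rightarrow> real^'n \<Rightarrow> real" where
  "react' x h = (LINT z|lborel. fz z *\<^sub>R (snd z \<bullet> G' (fst z, x, u t (fst z)) (0, h, 0)))"

lemmas regularity_intros = continuous_intros continuous_on_G continuous_on_G' continuous_on_u
  bounded_bilinear.continuous_on[OF bounded_bilinear_blinfun_compose] blinfun.continuous_on
  poly_growth_intros poly_growth_G poly_growth_G' poly_growth_u

text \<open>Under the integral, state and control are varied as one independent parameter pair; the
  map from \<open>x\<close> to \<open>(x, u t x)\<close> is composed afterwards. In this order no
  growth bound on the derivative of the control is called for, and none is available.\<close>

lemma has_derivative_vel: "(vel has_derivative (\<lambda>h. vel_x x h + vel_u x (u' t x h))) (at x)"
proof -
  define \<Phi> where "\<Phi> q = G (fst (fst q)) (fst (snd q)) (snd (fst q))"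
    for q :: "((real^'n) \<times> (real^'m)) \<times> ((real^'n) \<times> (real^'n))"
  define \<Phi>' where "\<Phi>' q = G' (fst (fst q), fst (snd q), snd (fst q)) o\<^sub>L in13"
    for q :: "((real^'n) \<times> (real^'m)) \<times> ((real^'n) \<times> (real^'n))"
  have \<Phi>: "poly_growth \<Phi>" "continuous_on UNIV \<Phi>" "poly_growth \<Phi>'" "continuous_on UNIV \<Phi>'"
    unfolding \<Phi>_def \<Phi>'_def by (intro regularity_intros)+
  have "((\<lambda>p. \<Phi> (p, z)) has_derivative \<Phi>' (p, z)) (at p)" for p z
    unfolding \<Phi>_def \<Phi>'_def fst_conv snd_conv
    by (rule has_derivative_eq_rhs[OF has_derivative_G[OF has_derivative_fst[OF has_derivative_ident]
          has_derivative_const has_derivative_snd[OF has_derivative_ident]]])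
       (simp add: in_apply fun_eq_iff)
  from has_derivative_weighted_integral[OF rapid_decay_fz continuous_on_fz \<Phi> this]
  have W: "((\<lambda>p. LINT z|lborel. fz z *\<^sub>R G (fst p) (fst z) (snd p)) has_derivative
      (\<lambda>h. LINT z|lborel. fz z *\<^sub>R G' (fst p, fst z, snd p) (fst h, 0, snd h))) (at p)" for p
    by (simp add: in_apply \<Phi>_def \<Phi>'_def)
  have "((\<lambda>x. (x, u t x)) has_derivative (\<lambda>h. (h, u' t x h))) (at x)"
    by (intro derivative_intros has_derivative_u)
  from has_derivative_compose[OF this W[of "(x, u t x)"]]
  have "(vel has_derivative (\<lambda>h. LINT z|lborel. fz z *\<^sub>R G' (x, fst z, u t x) (h, 0, u' t x h))) (at x)"
    by (simp add: OM_velocity_def[abs_def])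
  moreover have "(LINT z|lborel. fz z *\<^sub>R G' (x, fst z, u t x) (h, 0, v)) = vel_x x h + vel_u x v" for h v
  proof -
    have "G' p (h, 0, v) = G' p (h, 0, 0) + G' p (0, 0, v)" for p
      by (simp flip: blinfun.add_right)
    then show ?thesis
      unfolding vel_x_def vel_u_def
      by (subst Bochner_Integration.integral_add[symmetric])
         ((intro integrable_fz regularity_intros)+, simp add: scaleR_add_right)
  qed
  ultimately show ?thesis
    by simp
qed

lemma has_derivative_react: "(react has_derivative react' x) (at x)"
proof -
  define \<Phi> where "\<Phi> q = snd (snd q) \<bullet> G (fst (snd q)) (fst q) (u t (fst (snd q)))"
    for q :: "(real^'n) \<times> ((real^'n) \<times> (real^'n))"
  define \<Phi>' where "\<Phi>' q = blinfun_inner_right (snd (snd q)) o\<^sub>L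
      (G' (fst (snd q), fst q, u t (fst (snd q))) o\<^sub>L in2)"
    for q :: "(real^'n) \<times> ((real^'n) \<times> (real^'n))"
  have \<Phi>: "poly_growth \<Phi>" "continuous_on UNIV \<Phi>" "poly_growth \<Phi>'" "continuous_on UNIV \<Phi>'"
    unfolding \<Phi>_def \<Phi>'_def
    by (intro regularity_intros poly_growth_blinfun_inner_right
        bounded_linear.continuous_on[OF bounded_linear_blinfun_inner_right])+
  have "((\<lambda>x. \<Phi> (x, z)) has_derivative \<Phi>' (x, z)) (at x)" for x z
    unfolding \<Phi>_def \<Phi>'_def fst_conv snd_conv
    by (rule has_derivative_eq_rhs[OF has_derivative_inner_right[OF has_derivative_G[OF has_derivative_const
          has_derivative_ident has_derivative_const]]])
       (simp add: in_apply fun_eq_iff)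
  from has_derivative_weighted_integral[OF rapid_decay_fz continuous_on_fz \<Phi> this] show ?thesis
    by (simp add: react_def[abs_def] react'_def[abs_def] in_apply \<Phi>_def \<Phi>'_def)
qed

lemma continuous_on_vel: "continuous_on S vel"
  by (rule has_derivative_imp_continuous_on[OF has_derivative_vel])

lemma continuous_on_vel_x: "continuous_on UNIV (\<lambda>x. vel_x x e)"
proof -
  define \<Psi> where "\<Psi> q = G' (fst (fst q), fst (snd q), snd (fst q)) (e, 0, 0)"
    for q :: "((real^'n) \<times> (real^'m)) \<times> ((real^'n) \<times> (real^'n))"
  have "poly_growth \<Psi>" "continuous_on UNIV \<Psi>"
    unfolding \<Psi>_def by (intro regularity_intros)+
  from continuous_on_compose2[OF continuous_on_weighted_integral[OF rapid_decay_fz continuous_on_fz this]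
      continuous_on_Pair[OF continuous_on_id continuous_on_u[OF continuous_on_id]]]
  show ?thesis
    by (simp add: vel_x_def \<Psi>_def)
qed

lemma continuous_on_react': "continuous_on UNIV (\<lambda>x. react' x e)"
proof -
  define \<Psi> where "\<Psi> q = snd (snd q) \<bullet> G' (fst (snd q), fst q, u t (fst (snd q))) (0, e, 0)"
    for q :: "(real^'n) \<times> ((real^'n) \<times> (real^'n))"
  have "poly_growth \<Psi>" "continuous_on UNIV \<Psi>"
    unfolding \<Psi>_def by (intro regularity_intros)+
  from continuous_on_weighted_integral[OF rapid_decay_fz continuous_on_fz this]
  show ?thesis
    by (simp add: react'_def \<Psi>_def)
qed

end

lemma blinfun_apply_zero_Pair: "blinfun_apply X (0, 0) = 0"
  using blinfun.zero_right[of X] by (simp add: zero_prod_def)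

section \<open>Moments of \<open>fOM\<close> and their derivatives\<close>

context mean_field
begin

lemma fMO_eq_0: "x \<notin> density_support fMO t \<Longrightarrow> fMO t x = 0"
  using closure_subset[of "{x. fMO t x \<noteq> 0}"] unfolding density_support_def by blast

lemma has_derivative_\<Lambda>: "t \<in> {0..T} \<Longrightarrow> (\<Lambda> t has_derivative (\<lambda>h. \<Lambda>' (t, x) (0, h))) (at x)"
  using has_derivative_slice(1)[OF \<Lambda>(1)[unfolded C1_with_def, THEN conjunct1, rule_format, of "(t, x)"]]
  by simp

lemma gradient_\<Lambda>: "t \<in> {0..T} \<Longrightarrow> gradient (\<Lambda> t) x \<bullet> h = \<Lambda>' (t, x) (0, h)"
  by (rule gradient_inner[OF has_derivative_\<Lambda>])

text \<open>On the support the normalization of \<open>f2\<close> keeps \<open>c\<close>, and the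
  identification turns the mean of \<lambda> into -\<nabla>\<Lambda>; off the support
  \<open>fMO\<close> vanishes, and \<open>fOM\<close> with it. The affine weight serves for the
  mass, for each component of the first moment, and for the force, which is itself affine in
  \<lambda>.\<close>

lemma moment_eq:
  assumes t: "t \<in> {0..T}"
  shows "(LINT l|lborel. fOM t x l * (c + l \<bullet> e)) = fMO t x * (c - \<Lambda>' (t, x) (0, e))"
proof (cases "x \<in> density_support fMO t")
  case True
  note f2 = f2[OF t True]
  have "(LINT l|lborel. fOM t x l * (c + l \<bullet> e)) = (LINT l|lborel. fMO t x * (c * f2 t x l + (f2 t x l *\<^sub>R l) \<bullet> e))"
    by (simp add: factorization[OF t] algebra_simps)
  also have "\<dots> = fMO t x * (c + (LINT l|lborel. f2 t x l *\<^sub>R l) \<bullet> e)"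
    using f2 by (simp del: inner_scaleR_left)
  also have "(LINT l|lborel. f2 t x l *\<^sub>R l) \<bullet> e = - \<Lambda>' (t, x) (0, e)"
    using gradient_\<Lambda>[OF t, of x e] unfolding identification[OF t True] inner_minus_left by linarith
  finally show ?thesis
    by simp
next
  case False
  then show ?thesis
    by (simp add: factorization[OF t] fMO_eq_0)
qed

lemma fOM_integral: "t \<in> {0..T} \<Longrightarrow> (LINT l|lborel. fOM t x l) = fMO t x"
  using moment_eq[of t x 1 0] by (simp add: blinfun_apply_zero_Pair)

text \<open>The derivative of \<open>fMO\<close> in time and space, obtained from its role as the
  marginal of \<open>fOM\<close>.\<close>

definition fMO' :: "real \<times> (real^'n) \<Rightarrow> real \<times> (real^'n) \<Rightarrow> real" where
  "fMO' p h = (LINT l|lborel. f' (fst p, snd p, l) (fst h, snd h, 0))"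

text \<open>The product coincides on the slab with a moment of \<open>fOM\<close> and is therefore
  differentiable there. The case \<open>c = 1\<close>, \<open>e = 0\<close> is the differentiability
  of \<open>fMO\<close> itself.\<close>

lemma has_derivative_moment_eq:
  assumes "t \<in> {0..T}"
  shows "((\<lambda>p. fMO (fst p) (snd p) * (c - \<Lambda>' p (0, e))) has_derivative
      (\<lambda>h. LINT l|lborel. f' (t, x, l) (fst h, snd h, 0) * (c + l \<bullet> e))) (at (t, x) within {0..T} \<times> UNIV)"
proof -
  have "((\<lambda>p. LINT l|lborel. (\<lambda>(t, x, l). fOM t x l) (fst p, snd p, l) * (c + l \<bullet> e)) has_derivative
      (\<lambda>h. LINT l|lborel. f' (t, x, l) (fst h, snd h, 0) * (c + l \<bullet> e))) (at (t, x) within {0..T} \<times> UNIV)"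
  proof (rule has_derivative_moment[OF f _ _ _ assms])
    show "\<exists>C. \<forall>t\<in>{0..T}. \<forall>z. (1 + norm z) ^ k * (\<bar>(\<lambda>(t, x, l). fOM t x l) (t, z)\<bar> + norm (f' (t, z))) \<le> C" for k
      using f_decay[of k] by (simp add: case_prod_unfold)
  qed (intro continuous_intros poly_growth_intros)+
  then show ?thesis
  proof (rule has_derivative_transform[rotated 2])
    show "fMO (fst p) (snd p) * (c - \<Lambda>' p (0, e))
        = (LINT l|lborel. (\<lambda>(t, x, l). fOM t x l) (fst p, snd p, l) * (c + l \<bullet> e))"
      if "p \<in> {0..T} \<times> UNIV" for p
      using moment_eq[of "fst p" "snd p" c e] that by auto
  qed (use assms in simp)
qed

lemma has_derivative_fMO:
  assumes "t \<in> {0..T}"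
  shows "((\<lambda>p. fMO (fst p) (snd p)) has_derivative fMO' (t, x)) (at (t, x) within {0..T} \<times> UNIV)"
  using has_derivative_moment_eq[OF assms, of 1 0 x] by (simp add: fMO'_def[abs_def] blinfun_apply_zero_Pair)

text \<open>One function is differentiated twice over: under the integral sign and,
  \<open>fMO\<close> now being known to be differentiable, by the product rule. Uniqueness of
  derivatives on the slab equates the results, including at points where \<open>fMO\<close> is
  zero.\<close>

lemma moment_derivative_eq:
  assumes "t \<in> {0..T}"
  shows "(LINT l|lborel. f' (t, x, l) (fst h, snd h, 0) * (c + l \<bullet> e))
    = fMO' (t, x) h * (c - \<Lambda>' (t, x) (0, e)) - fMO t x * \<Lambda>'' (t, x) h (0, e)"
proof -
  have "(\<Lambda>' has_derivative \<Lambda>'' (t, x)) (at (t, x) within {0..T} \<times> UNIV)"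
    using \<Lambda>(2)[unfolded C1_with_def, THEN conjunct1, rule_format, of "(t, x)"] assms by simp
  from bounded_linear.has_derivative[OF blinfun.bounded_linear_left this]
  have "((\<lambda>p. \<Lambda>' p (0, e)) has_derivative (\<lambda>h. \<Lambda>'' (t, x) h (0, e))) (at (t, x) within {0..T} \<times> UNIV)" .
  then have "((\<lambda>p. fMO (fst p) (snd p) * (c - \<Lambda>' p (0, e))) has_derivative
      (\<lambda>h. fMO t x * (0 - \<Lambda>'' (t, x) h (0, e)) + fMO' (t, x) h * (c - \<Lambda>' (t, x) (0, e))))
      (at (t, x) within {0..T} \<times> UNIV)"
    using has_derivative_mult[OF has_derivative_fMO[OF assms] has_derivative_diff[OF has_derivative_const]] by simp
  from fun_cong[OF has_derivative_unique_time_space[OF T assms has_derivative_moment_eq[OF assms] this], of h]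
  show ?thesis
    by simp
qed

end

section \<open>Moments of the kinetic equation\<close>

context mean_field_at
begin

text \<open>Fubini, used to bring integrals over the hatted state in the mean-field system to the
  same kernel as in the kinetic system.\<close>

lemma marginal_integral:
  fixes \<Psi> :: "real^'n \<Rightarrow> 'b::{banach, second_countable_topology}"
  assumes "poly_growth \<Psi>" "continuous_on UNIV \<Psi>"
  shows "(LINT y|lborel. fMO t y *\<^sub>R \<Psi> y) = (LINT z|lborel. fz z *\<^sub>R \<Psi> (fst z))"
proof -
  have "integrable lborel (\<lambda>z. fz z *\<^sub>R \<Psi> (fst z))"
    by (intro integrable_fz poly_growth_compose[OF assms(1)] continuous_on_compose2[OF assms(2)] regularity_intros) simp
  then have "(LINT z|lborel. fz z *\<^sub>R \<Psi> (fst z)) = (LINT y|lborel. LINT l|lborel. fOM t y l *\<^sub>R \<Psi> y)"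
    by (subst lborel_integral_pair(2)) simp_all
  also have "\<dots> = (LINT y|lborel. (LINT l|lborel. fOM t y l) *\<^sub>R \<Psi> y)"
    using integrable_rapid_decay[OF rapid_decay_slice[OF rapid_decay_fz]
        borel_measurable_continuous_onI[OF continuous_on_slice(1)[OF continuous_on_fz]]]
    by (intro Bochner_Integration.integral_cong refl integral_scaleR_left) simp
  finally show ?thesis
    by (simp add: fOM_integral[OF t])
qed

lemma OM_velocity_eq: "(LINT y|lborel. fMO t y *\<^sub>R G x y (u t x)) = vel x"
  unfolding OM_velocity_def by (rule marginal_integral) (intro regularity_intros)+

lemma dt_fMO: "dt T (\<lambda>s. fMO s x) t = fMO' (t, x) (1, 0)"
  using dt_eq[OF T t has_derivative_slice(2)[OF has_derivative_fMO[OF t] t]] by simp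

lemma has_derivative_fMO_space: "(fMO t has_derivative (\<lambda>h. fMO' (t, x) (0, h))) (at x)"
  using has_derivative_slice(1)[OF has_derivative_fMO[OF t] t] by simp

lemma fMO'_split: "fMO' (t, x) (r, h) = fMO' (t, x) (r, 0) + fMO' (t, x) (0, h)"
  using linear_add[OF has_derivative_linear[OF has_derivative_fMO[OF t, of x]], of "(r, 0)" "(0, h)"] by simp

text \<open>The time derivative and the transport part of the divergence merge into one derivative
  of \<open>fMO\<close> along the space-time direction \<open>(1, vel x)\<close>. The moments of the
  kinetic equation contain the derivative of \<open>fOM\<close> in the same direction.\<close>

lemma MO_continuity_eq:
  "MO_continuity T G u fMO t x = fMO' (t, x) (1, vel x) + fMO t x * divergence vel x"
  unfolding MO_continuity_def OM_velocity_eq dt_fMO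
    divergence_scaleR[OF has_derivative_fMO_space has_derivative_vel]
  by (simp add: fMO'_split[of x 1 "vel x"])

text \<open>The part of the force on the multiplier that does not depend on \<lambda>; the rest is
  \<open>vel_x\<close>, transposed, applied to \<lambda>.\<close>

definition force :: "real^'n \<Rightarrow> real^'n \<Rightarrow> real" where
  "force x h = react' x h + J' (u t x, mt x) (0, mt' x h)"

lemma OM_force_inner: "OM_force G J mt u fOM t x l \<bullet> h = l \<bullet> vel_x x h + force x h"
proof -
  have int: "integrable lborel (\<lambda>z. fz z *\<^sub>R G' (x, fst z, u t x) (h, 0, 0))"
    "integrable lborel (\<lambda>z. fz z *\<^sub>R (l \<bullet> G' (x, fst z, u t x) (h, 0, 0)))"
    "integrable lborel (\<lambda>z. fz z *\<^sub>R (snd z \<bullet> G' (fst z, x, u t (fst z)) (0, h, 0)))"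
    by (intro integrable_fz regularity_intros)+
  have "integrable lborel (\<lambda>z. fz z *\<^sub>R (adjoint_apply (G' (x, fst z, u t x) o\<^sub>L in1) l
      + adjoint_apply (G' (fst z, x, u t (fst z)) o\<^sub>L in2) (snd z)))"
    by (intro integrable_fz regularity_intros poly_growth_adjoint_apply continuous_on_adjoint_apply)
  then have "OM_force G J mt u fOM t x l \<bullet> h = (LINT z|lborel. fz z *\<^sub>R (l \<bullet> G' (x, fst z, u t x) (h, 0, 0))
      + fz z *\<^sub>R (snd z \<bullet> G' (fst z, x, u t (fst z)) (0, h, 0)))
      + J' (u t x, mt x) (0, mt' x h)"
    unfolding OM_force_def transpose_D1 transpose_D2 inner_add_left transpose_jacobian_inner[OF has_derivative_mt]
      grad_m_inner
    by (subst integral_inner_left[symmetric]) (simp_all add: inner_add_left adjoint_apply_inner in_apply distrib_left)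
  also have "\<dots> = (LINT z|lborel. l \<bullet> fz z *\<^sub>R G' (x, fst z, u t x) (h, 0, 0)) + force x h"
    unfolding force_def react'_def by (subst Bochner_Integration.integral_add[OF int(2,3)]) simp
  also have "\<dots> = l \<bullet> vel_x x h + force x h"
    unfolding vel_x_def using int(1) by (subst integral_inner_right) auto
  finally show ?thesis .
qed

abbreviation kin :: "real^'n \<Rightarrow> real^'n \<Rightarrow> real" where
  "kin x l \<equiv> OM_kinetic T G J mt u fOM t x l"

text \<open>The transport terms give the derivative of the affine moment along
  \<open>(1, vel x)\<close> and the divergence of \<open>vel\<close> times that moment. Integration
  by parts replaces the \<lambda>-divergence by the moment of the force in direction
  \<open>e\<close>. All terms with the factor \<open>c - \<Lambda>' (t, x) (0, e)\<close> then
  collect into the continuity equation.\<close>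

lemma kinetic_moment:
  fixes c :: real and e :: "real^'n"
  shows "integrable lborel (\<lambda>l. (c + l \<bullet> e) * kin x l)"
    and "(LINT l|lborel. (c + l \<bullet> e) * kin x l) =
      (c - \<Lambda>' (t, x) (0, e)) * MO_continuity T G u fMO t x
      + fMO t x * (force x e - \<Lambda>' (t, x) (0, vel_x x e) - \<Lambda>'' (t, x) (1, vel x) (0, e))"
proof -
  let ?w = "\<lambda>l. c + l \<bullet> e"
  let ?F = "OM_force G J mt u fOM t x"
  \<comment> \<open>The force is affine in \<lambda>, so its derivative is this constant linear
    part, for which continuity and polynomial growth are immediate.\<close>
  define F' where "F' = Blinfun (\<lambda>l. \<Sum>b\<in>Basis. (l \<bullet> vel_x x b) *\<^sub>R b)"
  have F'_apply: "F' l = (\<Sum>b\<in>Basis. (l \<bullet> vel_x x b) *\<^sub>R b)" for l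
    unfolding F'_def
    by (subst bounded_linear_Blinfun_apply) (auto intro!: bounded_linear_sum bounded_linear_intros)
  have F: "?F = (\<lambda>l. \<Sum>b\<in>Basis. (l \<bullet> vel_x x b + force x b) *\<^sub>R b)"
    by (rule ext, rule euclidean_eqI) (simp add: OM_force_inner)
  have F': "(?F has_derivative F') (at l)" for l
    unfolding F by (rule has_derivative_eq_rhs, (rule derivative_intros)+) (simp add: F'_apply fun_eq_iff)
  have fl: "((\<lambda>l. fOM t x l) has_derivative (f' (t, x, l) o\<^sub>L Blinfun (\<lambda>k. (0, 0, k)))) (at l)" for l
  proof -
    have "((\<lambda>k. (x, k)) has_derivative (\<lambda>k. (0, k))) (at l)"
      by (intro derivative_intros)
    from has_derivative_compose[OF this has_derivative_fz]
    have "((\<lambda>l. fOM t x l) has_derivative (\<lambda>k. f' (t, x, l) (0, 0, k))) (at l)"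
      by simp
    then show ?thesis
      by (rule has_derivative_eq_rhs)
         (simp add: fun_eq_iff bounded_linear_Blinfun_apply bounded_linear_Pair bounded_linear_ident bounded_linear_zero)
  qed
  have rapid: "rapid_decay (\<lambda>l. fOM t x l)" "rapid_decay (\<lambda>l. f' (t, x, l))"
    using rapid_decay_slice[OF rapid_decay_fz, of x] rapid_decay_slice[OF rapid_decay_f', of x] by simp_all
  have cont: "continuous_on UNIV (\<lambda>l. fOM t x l)" "continuous_on UNIV (\<lambda>l. f' (t, x, l))"
    using continuous_on_slice(1)[OF continuous_on_fz, of UNIV x] by (simp, intro continuous_on_f' continuous_intros)
  have w: "continuous_on UNIV ?w" "poly_growth ?w"
    by (intro continuous_intros poly_growth_intros)+
  have growth_F: "poly_growth ?F"
    unfolding F by (intro poly_growth_sum poly_growth_intros)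
  have by_parts: "integrable lborel (\<lambda>l. ?w l * divergence (\<lambda>k. fOM t x k *\<^sub>R ?F k) l)"
    "(LINT l|lborel. ?w l * divergence (\<lambda>k. fOM t x k *\<^sub>R ?F k) l)
      = - (LINT l|lborel. fOM t x l * blinfun_inner_left e (?F l))"
  proof -
    have *: "rapid_decay (\<lambda>l. f' (t, x, l) o\<^sub>L Blinfun (\<lambda>k. (0, 0, k)))"
      by (rule rapid_decay_le_mult[OF rapid(2) poly_growth_const norm_blinfun_compose])
    have "((\<lambda>l. c + l \<bullet> e) has_derivative blinfun_apply (blinfun_inner_left e)) (at l)" for l
      by (auto intro!: derivative_eq_intros)
    note integral_divergence_by_parts[OF fl _ rapid(1) * F' continuous_on_const growth_F poly_growth_const
        this continuous_on_const w(2) poly_growth_const]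
    then show "integrable lborel (\<lambda>l. ?w l * divergence (\<lambda>k. fOM t x k *\<^sub>R ?F k) l)"
      "(LINT l|lborel. ?w l * divergence (\<lambda>k. fOM t x k *\<^sub>R ?F k) l)
        = - (LINT l|lborel. fOM t x l * blinfun_inner_left e (?F l))"
      by (simp_all add: cont bounded_bilinear.continuous_on[OF bounded_bilinear_blinfun_compose])
  qed
  have kin: "kin x l = f' (t, x, l) (1, vel x, 0) + fOM t x l * divergence vel x
      - divergence (\<lambda>k. fOM t x k *\<^sub>R ?F k) l" for l
  proof -
    have "((\<lambda>(t, x, l). fOM t x l) has_derivative f' (t, x, l)) (at (t, x, l) within {0..T} \<times> UNIV)"
      using f[unfolded C1_with_def, THEN conjunct1, rule_format, of "(t, x, l)"] t by simp
    from has_derivative_slice(2)[OF this t]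
    have "dt T (\<lambda>s. fOM s x l) t = f' (t, x, l) (1, 0)"
      by (intro dt_eq[OF T t]) simp
    moreover have "((\<lambda>y. fOM t y l) has_derivative (\<lambda>h. f' (t, x, l) (0, h, 0))) (at x)"
    proof -
      have "((\<lambda>y. (y, l)) has_derivative (\<lambda>h. (h, 0))) (at x)"
        by (intro derivative_intros)
      from has_derivative_compose[OF this has_derivative_fz] show ?thesis
        by simp
    qed
    moreover have "f' (t, x, l) (1, vel x, 0) = f' (t, x, l) (1, 0) + f' (t, x, l) (0, vel x, 0)"
      by (simp add: zero_prod_def flip: blinfun.add_right)
    ultimately show ?thesis
      by (simp add: OM_kinetic_def divergence_scaleR[OF _ has_derivative_vel])
  qed
  have int: "integrable lborel (\<lambda>l. f' (t, x, l) h * ?w l)" "integrable lborel (\<lambda>l. fOM t x l * ?w l)" for h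
  proof -
    have "rapid_decay (\<lambda>l. f' (t, x, l) h)"
      by (rule rapid_decay_le_mult[OF rapid(2) poly_growth_const norm_blinfun])
    from integrable_rapid_decay_scaleR[OF this _ w(2,1)] show "integrable lborel (\<lambda>l. f' (t, x, l) h * ?w l)"
      by (simp add: blinfun.continuous_on cont)
    from integrable_rapid_decay_scaleR[OF rapid(1) cont(1) w(2,1)] show "integrable lborel (\<lambda>l. fOM t x l * ?w l)"
      by simp
  qed
  have w_kin: "?w l * kin x l = f' (t, x, l) (1, vel x, 0) * ?w l + divergence vel x * (fOM t x l * ?w l)
      - ?w l * divergence (\<lambda>k. fOM t x k *\<^sub>R ?F k) l" for l
    by (simp add: kin algebra_simps)
  show "integrable lborel (\<lambda>l. ?w l * kin x l)"
    unfolding w_kin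
    by (intro Bochner_Integration.integrable_add Bochner_Integration.integrable_diff integrable_mult_right int by_parts)
  have "(LINT l|lborel. ?w l * kin x l) = (LINT l|lborel. f' (t, x, l) (1, vel x, 0) * ?w l)
      + divergence vel x * (LINT l|lborel. fOM t x l * ?w l) + (LINT l|lborel. fOM t x l * (?F l \<bullet> e))"
    unfolding w_kin using int by_parts
    by (simp add: Bochner_Integration.integral_add Bochner_Integration.integral_diff)
  also have "(LINT l|lborel. f' (t, x, l) (1, vel x, 0) * ?w l)
      = fMO' (t, x) (1, vel x) * (c - \<Lambda>' (t, x) (0, e)) - fMO t x * \<Lambda>'' (t, x) (1, vel x) (0, e)"
    using moment_derivative_eq[OF t, of x "(1, vel x)" c e] by simp
  also have "(LINT l|lborel. fOM t x l * ?w l) = fMO t x * (c - \<Lambda>' (t, x) (0, e))"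
    by (rule moment_eq[OF t])
  \<comment> \<open>The component of the force along \<open>e\<close> is again an affine weight,
    with constant part \<open>force x e\<close> and slope \<open>vel_x x e\<close>, so the same
    moment identity evaluates it.\<close>
  also have "(LINT l|lborel. fOM t x l * (?F l \<bullet> e)) = fMO t x * (force x e - \<Lambda>' (t, x) (0, vel_x x e))"
    using moment_eq[OF t, of x "force x e" "vel_x x e"] by (simp add: OM_force_inner add.commute)
  finally show "(LINT l|lborel. ?w l * kin x l) =
      (c - \<Lambda>' (t, x) (0, e)) * MO_continuity T G u fMO t x
      + fMO t x * (force x e - \<Lambda>' (t, x) (0, vel_x x e) - \<Lambda>'' (t, x) (1, vel x) (0, e))"
    unfolding MO_continuity_eq by (simp add: algebra_simps)
qed

end

lemma eq_0_iff_inner: "x = 0 \<longleftrightarrow> (\<forall>e. x \<bullet> e = 0)" for x :: "'a::real_inner"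
  using inner_eq_zero_iff[of x] by auto

section \<open>Comparison of the individual equations at a fixed time\<close>

context mean_field_at
begin

lemma blinfun_apply_zero_triple: "blinfun_apply X (0, 0, 0) = 0"
  using blinfun.zero_right[of X] by (simp add: zero_prod_def)

lemma kinetic_mass: "(LINT l|lborel. kin x l) = MO_continuity T G u fMO t x"
proof -
  have "force x 0 = 0" "vel_x x 0 = 0"
    by (simp_all add: force_def react'_def vel_x_def blinfun_apply_zero_triple blinfun_apply_zero_Pair)
  then show ?thesis
    using kinetic_moment(2)[where c = 1 and e = 0 and x = x] by (simp add: blinfun_apply_zero_Pair)
qed

text \<open>The component along \<open>e\<close> of the quantity E from the overview. Its last term
  is the derivative of \<nabla>\<Lambda> along the space-time direction
  \<open>(1, vel x)\<close>.\<close>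

definition adjoint_residual :: "real^'n \<Rightarrow> real^'n \<Rightarrow> real" where
  "adjoint_residual x e = force x e - \<Lambda>' (t, x) (0, vel_x x e) - \<Lambda>'' (t, x) (1, vel x) (0, e)"

lemma kinetic_flux:
  "(LINT l|lborel. kin x l *\<^sub>R l) \<bullet> e =
    fMO t x * adjoint_residual x e - gradient (\<Lambda> t) x \<bullet> e * MO_continuity T G u fMO t x"
proof -
  have *: "integrable lborel (\<lambda>l. (l \<bullet> e) * kin x l)" for e
    using kinetic_moment(1)[where c = 0 and x = x] by simp
  \<comment> \<open>The moment computation gives integrability only for scalar weights, so the
    vector-valued integrand is assembled from its components.\<close>
  have "kin x l *\<^sub>R l = (\<Sum>b\<in>Basis. ((l \<bullet> b) * kin x l) *\<^sub>R b)" for l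
    by (rule euclidean_eqI) (simp add: mult.commute)
  then have "integrable lborel (\<lambda>l. kin x l *\<^sub>R l)"
    using * by simp
  then have "(LINT l|lborel. kin x l *\<^sub>R l) \<bullet> e = (LINT l|lborel. (kin x l *\<^sub>R l) \<bullet> e)"
    by (simp only: integral_inner_left)
  also have "\<dots> = (LINT l|lborel. (l \<bullet> e) * kin x l)"
    by (simp add: mult.commute)
  finally show ?thesis
    using kinetic_moment(2)[where c = 0 and e = e and x = x]
    by (simp add: adjoint_residual_def gradient_\<Lambda>[OF t])
qed

lemma continuous_on_\<Lambda>: "continuous_on UNIV (\<lambda>x. \<Lambda>' (t, x))" "continuous_on UNIV (\<lambda>x. \<Lambda>'' (t, x))"
  using t by (auto intro!: continuous_intros continuous_on_compose2[OF C1_with_imp_continuous_on(1)[OF \<Lambda>(2)]]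
      continuous_on_compose2[OF C1_with_imp_continuous_on(2)[OF \<Lambda>(2)]])

lemma continuous_on_adjoint_residual: "continuous_on UNIV (\<lambda>x. adjoint_residual x e)"
proof -
  have cont_mt: "continuous_on UNIV mt" "continuous_on UNIV mt'"
    using C1_with_imp_continuous_on[OF mt] .
  have "continuous_on UNIV (\<lambda>x. J' (u t x, mt x))"
    by (intro continuous_on_compose2[OF C1_with_imp_continuous_on(2)[OF J]] continuous_on_Pair
        continuous_on_u continuous_on_id cont_mt) simp
  then show ?thesis
    unfolding adjoint_residual_def force_def
    by (intro continuous_intros continuous_on_\<Lambda> continuous_on_react' continuous_on_vel_x continuous_on_vel
        blinfun.continuous_on cont_mt)
qed

text \<open>The local terms of the control equation, common to both systems; what remains in each is
  \<open>vel_u\<close>, paired with \<lambda> or with -\<nabla>\<Lambda>.\<close>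

definition control_residual :: "real^'n \<Rightarrow> real^'m \<Rightarrow> real" where
  "control_residual x v = J' (u t x, mt x) (v, 0) + \<alpha> * (u t x \<bullet> v)"

lemma integral_Du:
  "(LINT z|lborel. fz z *\<^sub>R (transpose (Du G x (fst z) (u t x)) *v l)) \<bullet> v = l \<bullet> vel_u x v"
proof -
  have int: "integrable lborel (\<lambda>z. fz z *\<^sub>R adjoint_apply (G' (x, fst z, u t x) o\<^sub>L in3) l)"
    "integrable lborel (\<lambda>z. fz z *\<^sub>R G' (x, fst z, u t x) (0, 0, v))"
    by (intro integrable_fz regularity_intros poly_growth_adjoint_apply continuous_on_adjoint_apply)+
  have "(LINT z|lborel. fz z *\<^sub>R adjoint_apply (G' (x, fst z, u t x) o\<^sub>L in3) l) \<bullet> v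
      = (LINT z|lborel. l \<bullet> fz z *\<^sub>R G' (x, fst z, u t x) (0, 0, v))"
    using int(1) by (subst integral_inner_left[symmetric]) (simp_all add: adjoint_apply_inner in_apply)
  also have "\<dots> = l \<bullet> vel_u x v"
    unfolding vel_u_def using int(2) by (subst integral_inner_right) auto
  finally show ?thesis
    by (simp only: transpose_Du)
qed

lemma OM_control_inner: "OM_control G J mt \<alpha> u fOM t x l \<bullet> v = control_residual x v + l \<bullet> vel_u x v"
  by (simp only: OM_control_def inner_add_left integral_Du grad_u_inner control_residual_def inner_scaleR_left)

lemma MO_control_inner:
  "MO_control G J mt \<alpha> u fMO \<Lambda> t x \<bullet> v = control_residual x v - gradient (\<Lambda> t) x \<bullet> vel_u x v"
proof -
  have "(LINT y|lborel. fMO t y *\<^sub>R (transpose (Du G x y (u t x)) *v gradient (\<Lambda> t) x))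
      = (LINT z|lborel. fz z *\<^sub>R (transpose (Du G x (fst z) (u t x)) *v gradient (\<Lambda> t) x))"
    unfolding transpose_Du
    by (rule marginal_integral) (intro regularity_intros poly_growth_adjoint_apply continuous_on_adjoint_apply)+
  then show ?thesis
    by (simp only: MO_control_def inner_diff_left inner_add_left integral_Du grad_u_inner control_residual_def
        inner_scaleR_left)
qed

lemma averaged_OM_control:
  assumes "x \<in> density_support fMO t"
  shows "(LINT l|lborel. f2 t x l *\<^sub>R OM_control G J mt \<alpha> u fOM t x l) = MO_control G J mt \<alpha> u fMO \<Lambda> t x"
proof -
  note f2 = f2[OF t assms]
  have scalar: "(f2 t x l *\<^sub>R OM_control G J mt \<alpha> u fOM t x l) \<bullet> v
      = control_residual x v * f2 t x l + (f2 t x l *\<^sub>R l) \<bullet> vel_u x v" for l v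
    by (simp add: OM_control_inner algebra_simps)
  \<comment> \<open>Writing the integrand in components reduces its integrability to that of
    \<open>f2\<close> and of its first moment.\<close>
  have "f2 t x l *\<^sub>R OM_control G J mt \<alpha> u fOM t x l
      = (\<Sum>b\<in>Basis. (control_residual x b * f2 t x l + (f2 t x l *\<^sub>R l) \<bullet> vel_u x b) *\<^sub>R b)" for l
    by (rule euclidean_eqI) (simp only: scalar inner_sum_left_Basis)
  then have int: "integrable lborel (\<lambda>l. f2 t x l *\<^sub>R OM_control G J mt \<alpha> u fOM t x l)"
    using f2 by (simp del: inner_scaleR_left)
  have "(LINT l|lborel. f2 t x l *\<^sub>R OM_control G J mt \<alpha> u fOM t x l) \<bullet> v
      = (LINT l|lborel. control_residual x v * f2 t x l + (f2 t x l *\<^sub>R l) \<bullet> vel_u x v)" for v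
    unfolding scalar[symmetric] using int by (simp only: integral_inner_left)
  also have "\<dots> v = control_residual x v + (LINT l|lborel. f2 t x l *\<^sub>R l) \<bullet> vel_u x v" for v
    using f2 by (simp del: inner_scaleR_left)
  also have "\<dots> v = MO_control G J mt \<alpha> u fMO \<Lambda> t x \<bullet> v" for v
    unfolding MO_control_inner identification[OF t assms] by simp
  finally show ?thesis
    by (metis vector_eq_rdot)
qed

text \<open>At the hatted state, \<open>fMO\<close> times \<nabla>\<Lambda> is minus the first
  moment of \<open>fOM\<close>; this removes the gradient from under the integral and produces the
  sign of \<open>react\<close>. What remains of \<Lambda> is local: its derivative along
  \<open>(1, vel x)\<close>.\<close>

lemma MO_adjoint_eq:
  "MO_adjoint T G J mt \<alpha> u fMO \<Lambda> t x =
    J (u t x) (mt x) + \<alpha> / 2 * (u t x \<bullet> u t x) - \<Lambda>' (t, x) (1, vel x) + react x"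
proof -
  let ?q = "gradient (\<Lambda> t)"
  have int: "integrable lborel (\<lambda>z. fz z *\<^sub>R G x (fst z) (u t x))"
    "integrable lborel (\<lambda>z. fz z *\<^sub>R (snd z \<bullet> G (fst z) x (u t (fst z))))"
    by (intro integrable_fz regularity_intros)+
  \<comment> \<open>Both summands form a single affine moment at the hatted state \<open>y\<close>:
    the one with the gradient at \<open>x\<close> is the constant part, and the slope is
    \<open>- G y x (u t y)\<close>, its sign cancelling the one in the identification.\<close>
  have "(G x y (u t x) \<bullet> ?q x + G y x (u t y) \<bullet> ?q y) * fMO t y
      = (LINT l|lborel. fOM t y l * (?q x \<bullet> G x y (u t x) - l \<bullet> G y x (u t y)))" for y
    using moment_eq[OF t, of y "?q x \<bullet> G x y (u t x)" "- G y x (u t y)"]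
    by (simp add: gradient_\<Lambda>[OF t, symmetric] inner_commute[of _ "?q _"] algebra_simps)
  then have "(LINT y|lborel. (G x y (u t x) \<bullet> ?q x + G y x (u t y) \<bullet> ?q y) * fMO t y)
      = (LINT y|lborel. LINT l|lborel. fz (y, l) *\<^sub>R (?q x \<bullet> G x (fst (y, l)) (u t x) - snd (y, l) \<bullet> G (fst (y, l)) x (u t (fst (y, l)))))"
    by simp
  also have "\<dots> = (LINT z|lborel. fz z *\<^sub>R (?q x \<bullet> G x (fst z) (u t x) - snd z \<bullet> G (fst z) x (u t (fst z))))"
    by (rule lborel_integral_pair(2)[symmetric, OF integrable_fz])
       (rule poly_growth_le_add[of "\<lambda>z. ?q x \<bullet> G x (fst z) (u t x)" "\<lambda>z. snd z \<bullet> G (fst z) x (u t (fst z))"],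
         (intro regularity_intros norm_triangle_ineq4)+)
  also have "\<dots> = (LINT z|lborel. ?q x \<bullet> (fz z *\<^sub>R G x (fst z) (u t x)) - fz z *\<^sub>R (snd z \<bullet> G (fst z) x (u t (fst z))))"
    by (simp add: right_diff_distrib)
  also have "\<dots> = ?q x \<bullet> vel x - react x"
    unfolding OM_velocity_def react_def using int
    by (simp add: Bochner_Integration.integral_diff del: inner_scaleR_right real_scaleR_def)
  also have "?q x \<bullet> vel x = \<Lambda>' (t, x) (0, vel x)"
    by (rule gradient_\<Lambda>[OF t])
  finally have "(LINT y|lborel. (G x y (u t x) \<bullet> ?q x + G y x (u t y) \<bullet> ?q y) * fMO t y)
      = \<Lambda>' (t, x) (0, vel x) - react x" .
  moreover have "dt T (\<lambda>s. \<Lambda> s x) t = \<Lambda>' (t, x) (1, 0)"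
    using dt_eq[OF T t has_derivative_slice(2)[OF \<Lambda>(1)[unfolded C1_with_def, THEN conjunct1, rule_format, of "(t, x)"]]] t
    by simp
  moreover have "\<Lambda>' (t, x) (1, vel x) = \<Lambda>' (t, x) (1, 0) + \<Lambda>' (t, x) (0, vel x)"
    by (simp flip: blinfun.add_right)
  ultimately show ?thesis
    by (simp add: MO_adjoint_def power2_norm_eq_inner)
qed

text \<open>The symmetry lemma needs a parallelogram inside the slab, which a general direction
  \<open>(r, v)\<close> may leave. Spatial and temporal parts are therefore treated separately and
  recombined by linearity.\<close>

lemma \<Lambda>''_symmetric: "\<Lambda>'' (t, x) (r, v) (0, e) = \<Lambda>'' (t, x) (0, e) (r, v)"
proof -
  have space: "\<Lambda>'' (t, x) (0, v) (0, e) = \<Lambda>'' (t, x) (0, e) (0, v)"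
    by (rule second_derivative_symmetric[OF \<Lambda>]) (use t in auto)
  \<comment> \<open>At \<open>t = T\<close> the time direction has to point backwards to stay in the domain.\<close>
  define d where "d = (if t < T then T - t else - T)"
  have "\<Lambda>'' (t, x) (d, 0) (0, e) = \<Lambda>'' (t, x) (0, e) (d, 0)"
  proof (rule second_derivative_symmetric[OF \<Lambda>])
    fix \<sigma> \<tau> :: real
    assume \<sigma>: "\<sigma> \<in> {0..1}"
    have "t + \<sigma> * d \<in> {0..T}"
    proof (cases "t < T")
      case True
      then have "\<sigma> * d \<le> 1 * d" "0 \<le> \<sigma> * d" "t + d = T"
        using \<sigma> by (auto simp: d_def intro: mult_right_mono)
      then show ?thesis
        using t unfolding atLeastAtMost_iff by linarith
    next
      case False
      then have "\<sigma> * T \<le> 1 * T" "0 \<le> \<sigma> * T" "t = T"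
        using \<sigma> T t by (auto intro: mult_right_mono)
      then show ?thesis
        by (simp add: d_def)
    qed
    then show "(t, x) + \<sigma> *\<^sub>R (d, 0) + \<tau> *\<^sub>R (0, e) \<in> {0..T} \<times> UNIV"
      by simp
  qed
  moreover have "d \<noteq> 0"
    using T by (auto simp: d_def)
  \<comment> \<open>An arbitrary time component is a multiple of the admissible direction
    \<open>(d, 0)\<close>, so homogeneity extends the symmetry to it.\<close>
  moreover have "(r, 0) = (r / d) *\<^sub>R (d, 0::real^'n)"
    using \<open>d \<noteq> 0\<close> by simp
  ultimately have time: "\<Lambda>'' (t, x) (r, 0) (0, e) = \<Lambda>'' (t, x) (0, e) (r, 0)"
    by (simp only: blinfun.scaleR_right blinfun.scaleR_left)
  have "(r, v) = (r, 0) + (0, v)"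
    by simp
  then show ?thesis
    using space time by (simp only: blinfun.add_right blinfun.add_left)
qed

text \<open>Every term of the chain rule that passes through \<open>u' t x e\<close> belongs to the
  control equation tested against that vector. Symmetry of \<open>\<Lambda>''\<close> is needed
  because the spatial gradient differentiates the first derivative of \<Lambda> along
  \<open>(1, vel x)\<close> with respect to \<open>x\<close>, while the kinetic moment
  differentiates \<nabla>\<Lambda> along \<open>(1, vel x)\<close>.\<close>

lemma MO_adjoint_gradient:
  "gradient (MO_adjoint T G J mt \<alpha> u fMO \<Lambda> t) x \<bullet> e
    = adjoint_residual x e + MO_control G J mt \<alpha> u fMO \<Lambda> t x \<bullet> u' t x e"
proof -
  have \<Lambda>'_der: "((\<lambda>y. \<Lambda>' (t, y)) has_derivative (\<lambda>h. \<Lambda>'' (t, x) (0, h))) (at x)"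
    using has_derivative_slice(1)[OF \<Lambda>(2)[unfolded C1_with_def, THEN conjunct1, rule_format, of "(t, x)"] t] t
    by simp
  have pair: "((\<lambda>y. (1::real, vel y)) has_derivative (\<lambda>h. (0, vel_x x h + vel_u x (u' t x h)))) (at x)"
    by (intro derivative_intros has_derivative_vel)
  have "((\<lambda>y. J (u t y) (mt y) + \<alpha> / 2 * (u t y \<bullet> u t y) - \<Lambda>' (t, y) (1, vel y) + react y) has_derivative
      (\<lambda>h. J' (u t x, mt x) (u' t x h, mt' x h) + \<alpha> / 2 * (u t x \<bullet> u' t x h + u' t x h \<bullet> u t x)
        - (\<Lambda>' (t, x) (0, vel_x x h + vel_u x (u' t x h)) + \<Lambda>'' (t, x) (0, h) (1, vel x)) + react' x h)) (at x)"
    by (intro has_derivative_add has_derivative_diff has_derivative_mult_right has_derivative_inner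
        has_derivative_u has_derivative_mt has_derivative_J has_derivative_react
        bounded_bilinear.FDERIV[OF bounded_bilinear_blinfun_apply \<Lambda>'_der pair])
  then have "gradient (MO_adjoint T G J mt \<alpha> u fMO \<Lambda> t) x \<bullet> e
    = J' (u t x, mt x) (u' t x e, mt' x e) + \<alpha> / 2 * (u t x \<bullet> u' t x e + u' t x e \<bullet> u t x)
        - (\<Lambda>' (t, x) (0, vel_x x e + vel_u x (u' t x e)) + \<Lambda>'' (t, x) (0, e) (1, vel x)) + react' x e"
    unfolding MO_adjoint_eq[abs_def, symmetric] by (rule gradient_inner)
  moreover have "J' (u t x, mt x) (u' t x e, mt' x e) = J' (u t x, mt x) (u' t x e, 0) + J' (u t x, mt x) (0, mt' x e)"
    by (simp flip: blinfun.add_right)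
  moreover have "\<Lambda>' (t, x) (0, vel_x x e + vel_u x (u' t x e))
      = \<Lambda>' (t, x) (0, vel_x x e) + \<Lambda>' (t, x) (0, vel_u x (u' t x e))"
    by (simp flip: blinfun.add_right)
  ultimately show ?thesis
    by (simp add: MO_control_inner adjoint_residual_def force_def control_residual_def gradient_\<Lambda>[OF t]
        \<Lambda>''_symmetric inner_commute[of "u' t x e"])
qed

lemma zero_on_density_support_iff:
  assumes "continuous_on UNIV g"
  shows "(\<forall>x. fMO t x * g x = 0) \<longleftrightarrow> (\<forall>x\<in>density_support fMO t. g x = 0)"
proof
  assume "\<forall>x\<in>density_support fMO t. g x = 0"
  then show "\<forall>x. fMO t x * g x = 0"
    using fMO_eq_0[of _ t] by fastforce
qed (auto simp: density_support_def intro: eq_0_on_support[OF assms, of "fMO t"])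

text \<open>The flux differs from \<open>fMO\<close> times the residual by a multiple of the
  continuity equation, and the gradient of the adjoint equation differs from the residual by the
  control equation paired with \<open>u'\<close>. The equivalence is therefore stated modulo these
  two equations.\<close>

lemma kinetic_flux_zero_iff:
  assumes cont: "\<And>x. MO_continuity T G u fMO t x = 0"
    and control: "\<And>x. x \<in> density_support fMO t \<Longrightarrow> MO_control G J mt \<alpha> u fMO \<Lambda> t x = 0"
  shows "(\<forall>x. (LINT l|lborel. kin x l *\<^sub>R l) = 0) \<longleftrightarrow>
    (\<forall>x\<in>density_support fMO t. gradient (MO_adjoint T G J mt \<alpha> u fMO \<Lambda> t) x = 0)"
proof -
  have "(\<forall>x. (LINT l|lborel. kin x l *\<^sub>R l) = 0) \<longleftrightarrow> (\<forall>x e. (LINT l|lborel. kin x l *\<^sub>R l) \<bullet> e = 0)"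
    by (simp only: eq_0_iff_inner[where 'a = "real^'n"])
  also have "\<dots> \<longleftrightarrow> (\<forall>x e. fMO t x * adjoint_residual x e = 0)"
    by (simp only: kinetic_flux cont mult_zero_right diff_zero)
  also have "\<dots> \<longleftrightarrow> (\<forall>x\<in>density_support fMO t. \<forall>e. adjoint_residual x e = 0)"
    using zero_on_density_support_iff[OF continuous_on_adjoint_residual] by blast
  also have "\<dots> \<longleftrightarrow> (\<forall>x\<in>density_support fMO t. \<forall>e. gradient (MO_adjoint T G J mt \<alpha> u fMO \<Lambda> t) x \<bullet> e = 0)"
    by (simp only: MO_adjoint_gradient control inner_zero_left add_0_right cong: ball_cong)
  also have "\<dots> \<longleftrightarrow> (\<forall>x\<in>density_support fMO t. gradient (MO_adjoint T G J mt \<alpha> u fMO \<Lambda> t) x = 0)"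
    by (simp only: eq_0_iff_inner[where 'a = "real^'n"])
  finally show ?thesis .
qed

text \<open>At \<open>t = T\<close> this matches the two terminal conditions; the passage between
  the support and the whole space is the same as for the flux.\<close>

lemma mean_multiplier_zero_iff:
  "(\<forall>x. (LINT l|lborel. fOM t x l *\<^sub>R l) = 0) \<longleftrightarrow> (\<forall>x\<in>density_support fMO t. gradient (\<Lambda> t) x = 0)"
proof -
  have "(LINT l|lborel. fOM t x l *\<^sub>R l) \<bullet> e = - (fMO t x * \<Lambda>' (t, x) (0, e))" for x e
  proof -
    have "integrable lborel (\<lambda>l. fOM t x l *\<^sub>R l)"
      using rapid_decay_slice[OF rapid_decay_fz, of x] continuous_on_slice(1)[OF continuous_on_fz, of UNIV x]
      by (intro integrable_rapid_decay_scaleR poly_growth_ident continuous_on_id) simp_all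
    then have "(LINT l|lborel. fOM t x l *\<^sub>R l) \<bullet> e = (LINT l|lborel. fOM t x l * (0 + l \<bullet> e))"
      by (subst integral_inner_left[symmetric]) simp_all
    then show ?thesis
      using moment_eq[OF t, of x 0 e] by simp
  qed
  then have "(\<forall>x. (LINT l|lborel. fOM t x l *\<^sub>R l) = 0) \<longleftrightarrow> (\<forall>x e. fMO t x * \<Lambda>' (t, x) (0, e) = 0)"
    by (simp only: eq_0_iff_inner[where 'a = "real^'n"] neg_equal_0_iff_equal)
  also have "\<dots> \<longleftrightarrow> (\<forall>x\<in>density_support fMO t. \<forall>e. \<Lambda>' (t, x) (0, e) = 0)"
    using zero_on_density_support_iff[OF blinfun.continuous_on[OF continuous_on_\<Lambda>(1) continuous_on_const]] by blast
  also have "\<dots> \<longleftrightarrow> (\<forall>x\<in>density_support fMO t. gradient (\<Lambda> t) x = 0)"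
    by (simp only: eq_0_iff_inner[where 'a = "real^'n"] gradient_\<Lambda>[OF t])
  finally show ?thesis .
qed

end

section \<open>Equivalence of the systems over the whole horizon\<close>

context mean_field
begin

lemma mean_field_at: "t \<in> {0..T} \<Longrightarrow> mean_field_at T G J mt u fOM f2 fMO \<Lambda> G' J' mt' u' f' \<Lambda>' \<Lambda>'' t"
  by unfold_locales

lemma OM_system_moments_iff_MO_system_grad:
  assumes "\<And>x. f0MO x = (LINT l|lborel. f0OM x l)"
  shows "OM_system_moments T G J mt \<alpha> f0OM u fOM fMO f2 \<longleftrightarrow> MO_system_grad T G J mt \<alpha> f0MO u fMO \<Lambda>"
proof -
  have 0: "0 \<in> {0..T}" and T': "T \<in> {0..T}"
    using T by auto
  have init: "(\<forall>x. (LINT l|lborel. fOM 0 x l) = (LINT l|lborel. f0OM x l)) \<longleftrightarrow> (\<forall>x. fMO 0 x = f0MO x)"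
    using fOM_integral[OF 0] assms by simp
  have cont: "(\<forall>t\<in>{0..T}. \<forall>x. (LINT l|lborel. OM_kinetic T G J mt u fOM t x l) = 0)
      \<longleftrightarrow> (\<forall>t\<in>{0..T}. \<forall>x. MO_continuity T G u fMO t x = 0)"
    using mean_field_at.kinetic_mass[OF mean_field_at] by simp
  have control: "(\<forall>t\<in>{0..T}. \<forall>x\<in>density_support fMO t.
        (LINT l|lborel. f2 t x l *\<^sub>R OM_control G J mt \<alpha> u fOM t x l) = 0)
      \<longleftrightarrow> (\<forall>t\<in>{0..T}. \<forall>x\<in>density_support fMO t. MO_control G J mt \<alpha> u fMO \<Lambda> t x = 0)"
    using mean_field_at.averaged_OM_control[OF mean_field_at] by simp
  \<comment> \<open>A conditional equivalence suffices: after the other equations have been matched,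
    its two premises are conjuncts of both systems.\<close>
  have flux: "(\<forall>t\<in>{0..T}. \<forall>x. (LINT l|lborel. OM_kinetic T G J mt u fOM t x l *\<^sub>R l) = 0)
      \<longleftrightarrow> (\<forall>t\<in>{0..T}. \<forall>x\<in>density_support fMO t. gradient (MO_adjoint T G J mt \<alpha> u fMO \<Lambda> t) x = 0)"
    if "\<forall>t\<in>{0..T}. \<forall>x. MO_continuity T G u fMO t x = 0"
      "\<forall>t\<in>{0..T}. \<forall>x\<in>density_support fMO t. MO_control G J mt \<alpha> u fMO \<Lambda> t x = 0"
    by (rule ball_cong[OF refl mean_field_at.kinetic_flux_zero_iff[OF mean_field_at]]) (use that in auto)
  show ?thesis
    unfolding OM_system_moments_def MO_system_grad_def init cont control
      mean_field_at.mean_multiplier_zero_iff[OF mean_field_at[OF T']]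
    using flux by blast
qed

end

theorem lemma2p2:
  fixes T \<alpha> :: real
    and G :: "real^'n \<Rightarrow> real^'n \<Rightarrow> real^'m \<Rightarrow> real^'n"
    and J :: "real^'m \<Rightarrow> real^'n \<Rightarrow> real"
    and mt :: "real^'n \<Rightarrow> real^'n"
    and u :: "real \<Rightarrow> real^'n \<Rightarrow> real^'m"
    and f0OM :: "real^'n \<Rightarrow> real^'n \<Rightarrow> real"
    and f0MO :: "real^'n \<Rightarrow> real"
    and fOM f2 :: "real \<Rightarrow> real^'n \<Rightarrow> real^'n \<Rightarrow> real"
    and fMO \<Lambda> :: "real \<Rightarrow> real^'n \<Rightarrow> real"
  assumes T: "T > 0" and alpha: "\<alpha> > 0"
    and G_reg: "C1_poly_growth (\<lambda>(x, y, v). G x y v)"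
    and J_reg: "C1_on UNIV (\<lambda>(v, p). J v p)"
    and mt_reg: "C1_on UNIV mt"
    and u_reg: "\<And>t. t \<in> {0..T} \<Longrightarrow> C1_on UNIV (u t) \<and> poly_growth (u t)"
    and fOM_reg: "C1_rapid_decay T (\<lambda>(t, x, l). fOM t x l)"
    and Lambda_reg: "C2_on ({0..T} \<times> UNIV) (\<lambda>(t, x). \<Lambda> t x)"
    and fMO_nonneg: "\<And>t x. t \<in> {0..T} \<Longrightarrow> fMO t x \<ge> 0"
    and f2_density: "\<And>t x. t \<in> {0..T} \<Longrightarrow> x \<in> density_support fMO t \<Longrightarrow>
        (\<forall>l. f2 t x l \<ge> 0) \<and> integrable lborel (f2 t x) \<and> (LINT l|lborel. f2 t x l) = 1 \<and>
        integrable lborel (\<lambda>l. f2 t x l *\<^sub>R l)"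
    and factorization: "\<And>t x l. t \<in> {0..T} \<Longrightarrow> fOM t x l = fMO t x * f2 t x l"
    and initial_data: "\<And>x. f0MO x = (LINT l|lborel. f0OM x l)"
    and identification: "\<And>t x. t \<in> {0..T} \<Longrightarrow> x \<in> density_support fMO t \<Longrightarrow>
        gradient (\<Lambda> t) x = - (LINT l|lborel. f2 t x l *\<^sub>R l)"
  shows "(OM_system T G J mt \<alpha> f0OM u fOM fMO f2 \<longrightarrow> MO_system_grad T G J mt \<alpha> f0MO u fMO \<Lambda>) \<and>
    (MO_system T G J mt \<alpha> f0MO u fMO \<Lambda> \<longrightarrow> OM_system_moments T G J mt \<alpha> f0OM u fOM fMO f2) \<and>
    (OM_system_moments T G J mt \<alpha> f0OM u fOM fMO f2 \<longleftrightarrow> MO_system_grad T G J mt \<alpha> f0MO u fMO \<Lambda>)"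
proof -
  obtain G' where G': "C1_with UNIV (\<lambda>(x, y, v). G x y v) G'" "poly_growth (\<lambda>(x, y, v). G x y v)" "poly_growth G'"
    using G_reg unfolding C1_poly_growth_def by blast
  obtain J' where J': "C1_with UNIV (\<lambda>(v, p). J v p) J'"
    using J_reg unfolding C1_on_def by blast
  obtain mt' where mt': "C1_with UNIV mt mt'"
    using mt_reg unfolding C1_on_def by blast
  \<comment> \<open>The derivative is chosen separately for each time, because the control is
    regular in \<open>x\<close> at fixed \<open>t\<close>.\<close>
  obtain u' where u': "\<And>t. t \<in> {0..T} \<Longrightarrow> C1_with UNIV (u t) (u' t)"
    using u_reg unfolding C1_on_def by metis
  obtain f' where f': "C1_with ({0..T} \<times> UNIV) (\<lambda>(t, x, l). fOM t x l) f'"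
    "\<And>k. \<exists>C. \<forall>t\<in>{0..T}. \<forall>z. (1 + norm z) ^ k * (\<bar>fOM t (fst z) (snd z)\<bar> + norm (f' (t, z))) \<le> C"
    using fOM_reg unfolding C1_rapid_decay_def by (auto simp: case_prod_unfold)
  obtain \<Lambda>' \<Lambda>'' where \<Lambda>': "C1_with ({0..T} \<times> UNIV) (\<lambda>(t, x). \<Lambda> t x) \<Lambda>'"
    "C1_with ({0..T} \<times> UNIV) \<Lambda>' \<Lambda>''"
    using Lambda_reg unfolding C2_on_def C1_on_def by blast
  interpret mean_field T \<alpha> G J mt u fOM f2 fMO \<Lambda> G' J' mt' u' f' \<Lambda>' \<Lambda>''
    by unfold_locales (use T G' J' mt' u' u_reg f' \<Lambda>' f2_density factorization identification in blast)+
  have iff: "OM_system_moments T G J mt \<alpha> f0OM u fOM fMO f2 \<longleftrightarrow> MO_system_grad T G J mt \<alpha> f0MO u fMO \<Lambda>"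
    by (rule OM_system_moments_iff_MO_system_grad[OF initial_data])
  have grad_zero: "gradient (\<lambda>_. 0) x = 0" for x :: "real^'n"
    using gradient_inner[of "\<lambda>_. 0" "\<lambda>_. 0" x] by (metis has_derivative_const inner_eq_zero_iff)
  \<comment> \<open>The adjoint equation and the terminal condition hold at all \<open>x\<close>, so
    the functions themselves are zero and may be differentiated; vanishing on the support alone
    would not determine their gradients there.\<close>
  have "MO_system_grad T G J mt \<alpha> f0MO u fMO \<Lambda>" if "MO_system T G J mt \<alpha> f0MO u fMO \<Lambda>"
  proof -
    note MO = that
    then have "MO_adjoint T G J mt \<alpha> u fMO \<Lambda> t = (\<lambda>_. 0)" if "t \<in> {0..T}" for t
      using that unfolding MO_system_def by blast
    moreover have "\<Lambda> T = (\<lambda>_. 0)"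
      using MO unfolding MO_system_def by blast
    ultimately show ?thesis
      using MO grad_zero unfolding MO_system_def MO_system_grad_def by simp
  qed
  \<comment> \<open>The pointwise kinetic equation makes both integrands vanish identically, and
    equal initial densities have equal marginals.\<close>
  moreover have "OM_system_moments T G J mt \<alpha> f0OM u fOM fMO f2"
    if "OM_system T G J mt \<alpha> f0OM u fOM fMO f2"
  proof -
    note OM = that
    then have "OM_kinetic T G J mt u fOM t x = (\<lambda>_. 0)" if "t \<in> {0..T}" for t x
      using that unfolding OM_system_def by blast
    moreover have "fOM 0 = f0OM"
      using OM unfolding OM_system_def by blast
    ultimately show ?thesis
      using OM unfolding OM_system_def OM_system_moments_def by simp
  qed
  ultimately show ?thesis
    using iff by blast
qed

end
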